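(* Let $\alpha,\beta,\sigma$, $\eta=\alpha\beta$, $(s_n)_{n\ge0}$, $\mu_{\alpha,\beta,\sigma}$, $X_{\alpha,\beta}$, $\mathbb F_{\eta,\sigma}(\mathbb C)$ and the unitary operator $\mathbb S:L^2(X_{\alpha,\beta},\mu_{\alpha,\beta,\sigma})\to\mathbb F_{\eta,\sigma}(\mathbb C)$, $(\mathbb S s_n)(z)=z^n$, be as in the context. Define $$\mathbb E(x,z)=\sum_{n=0}^\infty\frac{z^n}{n!\,(\sigma\mid-\eta)_n}\,s_n(x),\qquad x\in X_{\alpha,\beta},\ z\in\mathbb C.$$ Then $\mathbb E(\cdot,z)\in L^2(X_{\alpha,\beta},\mu_{\alpha,\beta,\sigma})$ for each $z\in\mathbb C$, and for every $f\in L^2(X_{\alpha,\beta},\mu_{\alpha,\beta,\sigma})$ $$(\mathbb S f)(z)=\int_{X_{\alpha,\beta}}f(x)\,\mathbb E(x,z)\,\mu_{\alpha,\beta,\sigma}(dx),\qquad z\in\mathbb C.$$ Furthermore: (i) if $\alpha=\beta>0$, $$\mathbb E(x,z)=\int_{\mathbb N_0}\big[(\sigma/\eta)^{(\xi)}\big]^{-1}\Big(\frac x\alpha\Big)^{\xi}\,\pi_{\frac z\alpha}(d\xi),\qquad x\in(0,\infty),\ z\in\mathbb C;$$ (ii) if $\alpha>\beta>0$, $$\mathbb E((\alpha-\beta)n,z)=\int_{\mathbb N_0}\Big(1-\frac\beta\alpha\Big)^{\xi}\,\frac{(\xi\eta+\sigma\mid-\eta)_n}{(\sigma\mid-\eta)_n}\,\pi_{\frac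 z\beta}(d\xi),\qquad n\in\mathbb N_0,\ z\in\mathbb C;$$ (iii) if $\Re(\alpha)\ge0$, $\Im(\alpha)>0$, $\beta=\overline\alpha$, $$\mathbb E(x,z)=\int_{\mathbb N_0}\Big(2\cos\big(\tfrac\pi2-\operatorname{Arg}(\alpha)\big)\Big)^{\xi}\big[(\sigma/\eta)^{(\xi)}\big]^{-1}\exp\Big(i\big(\tfrac\pi2-\operatorname{Arg}(\alpha)\big)\xi\Big)\Big(-\frac{ix}{2\Im(\alpha)}-\frac{i\sigma\alpha}{2\eta\Im(\alpha)}\Big)^{(\xi)}\,\pi_{\frac z\beta}(d\xi)$$ for $x\in\mathbb R$, $z\in\mathbb C$, where $\operatorname{Arg}(\alpha)\in(0,\pi/2]$.
   Context: Notation: $\mathbb N_0=\{0,1,2,\dots\}$. For $z,h\in\mathbb C$: $(z\mid h)_0=1$, $(z\mid h)_n=z(z-h)(z-2h)\cdots(z-(n-1)h)$; $(z)^{(n)}=(z\mid-1)_n=z(z+1)\cdots(z+n-1)$ is the rising factorial. Parameters: $\sigma>0$, and $\alpha,\beta\in\mathbb C$ satisfy one of: $\alpha=\beta>0$ (gamma case); $\alpha>\beta>0$ (negative binomial case); $\Re(\alpha)\ge0$, $\Im(\alpha)>0$, $\beta=\overline\alpha$ (Meixner case). Put $\lambda=\alpha+\beta$, $\eta=\alpha\beta>0$, and $l=\sigma/\alpha$ in the first two cases, $l=0$ in the Meixner case. $(s_n)_{n\ge0}$ is the monic polynomial sequence with $s_0=1$ and $xs_n(x)=s_{n+1}(x)+(\lambda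 n+l)s_n(x)+(\sigma n+\eta n(n-1))s_{n-1}(x)$. It is orthogonal with respect to the probability measure $\mu_{\alpha,\beta,\sigma}$ on $X_{\alpha,\beta}$, with $\|s_n\|^2_{L^2}=n!\,(\sigma\mid-\eta)_n$, where: - gamma case: $X_{\alpha,\beta}=(0,\infty)$, $\mu_{\alpha,\alpha,\sigma}(dx)=\frac1{\Gamma(\sigma/\eta)}\alpha^{-\sigma/\eta}x^{-1+\sigma/\eta}e^{-x/\alpha}dx$; - negative binomial case: $X_{\alpha,\beta}=(\alpha-\beta)\mathbb N_0$, $\mu_{\alpha,\beta,\sigma}=(1-\frac\beta\alpha)^{\sigma/\eta}\sum_{n\ge0}(\frac\beta\alpha)^n\frac1{n!}(\frac\sigma\eta)^{(n)}\delta_{(\alpha-\beta)n}$; - Meixner case: $X_{\alpha,\beta}=\mathbb R$, $\mu_{\alpha,\beta,\sigma}(dx)=C_{\alpha,\beta,\sigma}\exp\big((\frac\pi2-\operatorname{Arg}(\alpha))x/\Im(\alpha)\big)\big|\Gamma\big(\frac{ix}{2\Im(\alpha)}+\frac{i\sigma\beta}{2\eta\Im(\alpha)}\big)\big|^2dx$, with $\operatorname{Arg}(\alpha)\in(0,\pi/2]$ and $C_{\alpha,\beta,\sigma}=\frac{(2\cos(\frac\pi2-\operatorname{Arg}(\alpha)))^{\sigma/\eta}}{4\Im(\alpha)\pi\Gamma(\sigma/\eta)}\exp\big(\frac{(\frac\pi2-\operatorname{Arg}(\alpha))\sigma\Re(\alpha)}{\Im(\alpha)\eta}\big)$. $L^2$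 spaces are complex. $\mathbb F_{\eta,\sigma}(\mathbb C)$ is the Hilbert space of entire functions $\varphi(z)=\sum_{n\ge0}f_nz^n$ with $\sum_n|f_n|^2n!\,(\sigma\mid-\eta)_n<\infty$ and inner product $(\varphi,\psi)=\sum_nf_n\overline{g_n}\,n!\,(\sigma\mid-\eta)_n$ (where $\psi(z)=\sum_n g_nz^n$). The generalized Segal–Bargmann transform $\mathbb S:L^2(X_{\alpha,\beta},\mu_{\alpha,\beta,\sigma})\to\mathbb F_{\eta,\sigma}(\mathbb C)$ is the unitary operator with $(\mathbb Ss_n)(z)=z^n$ for all $n\in\mathbb N_0$. For $\zeta\in\mathbb C$, $\pi_\zeta$ is the complex-valued Poisson measure on $\mathbb N_0$: $\pi_\zeta=e^{-\zeta}\sum_{n\ge0}\frac{\zeta^n}{n!}\delta_n$. *)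

theory Defs
  imports "HOL-Complex_Analysis.Complex_Analysis"
begin

section \<open>Parameters\<close>

definition gamma_case :: "complex \<Rightarrow> complex \<Rightarrow> bool" where
  "gamma_case \<alpha> \<beta> \<longleftrightarrow> \<alpha> \<in> \<real> \<and> 0 < Re \<alpha> \<and> \<beta> = \<alpha>"

definition negbin_case :: "complex \<Rightarrow> complex \<Rightarrow> bool" where
  "negbin_case \<alpha> \<beta> \<longleftrightarrow> \<alpha> \<in> \<real> \<and> \<beta> \<in> \<real> \<and> 0 < Re \<beta> \<and> Re \<beta> < Re \<alpha>"

definition meixner_case :: "complex \<Rightarrow> complex \<Rightarrow> bool" where
  "meixner_case \<alpha> \<beta> \<longleftrightarrow> 0 \<le> Re \<alpha> \<and> 0 < Im \<alpha> \<and> \<beta> = cnj \<alpha>"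

text \<open>
  In each of the three cases \<open>\<alpha> + \<beta>\<close> and \<open>\<alpha> * \<beta>\<close> are real, so taking real parts below loses
  nothing; likewise \<open>\<alpha>\<close> itself is real in the first two cases.
\<close>

definition lam :: "complex \<Rightarrow> complex \<Rightarrow> real" where
  "lam \<alpha> \<beta> = Re (\<alpha> + \<beta>)"

definition eta :: "complex \<Rightarrow> complex \<Rightarrow> real" where
  "eta \<alpha> \<beta> = Re (\<alpha> * \<beta>)"

definition shift :: "complex \<Rightarrow> complex \<Rightarrow> real \<Rightarrow> real" where
  "shift \<alpha> \<beta> \<sigma> = (if meixner_case \<alpha> \<beta> then 0 else \<sigma> / Re \<alpha>)"


section \<open>The orthogonal polynomials\<close>

text \<open>\<open>gfact z h n = z (z - h) (z - 2 h) \<dots> (z - (n - 1) h)\<close>\<close>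

definition gfact :: "'a::comm_ring_1 \<Rightarrow> 'a \<Rightarrow> nat \<Rightarrow> 'a" where
  "gfact z h n = (\<Prod>k<n. z - of_nat k * h)"

text \<open>
  The recurrence \<open>x s\<^sub>n = s\<^sub>n\<^sub>+\<^sub>1 + (\<lambda> n + l) s\<^sub>n + (\<sigma> n + \<eta> n (n - 1)) s\<^sub>n\<^sub>-\<^sub>1\<close>,
  solved for \<open>s\<^sub>n\<^sub>+\<^sub>1\<close>; at \<open>n = 0\<close> the coefficient of \<open>s\<^sub>n\<^sub>-\<^sub>1\<close> vanishes.
\<close>

fun s_poly :: "complex \<Rightarrow> complex \<Rightarrow> real \<Rightarrow> nat \<Rightarrow> real poly" where
  "s_poly \<alpha> \<beta> \<sigma> 0 = 1"
| "s_poly \<alpha> \<beta> \<sigma> (Suc 0) = [:- shift \<alpha> \<beta> \<sigma>, 1:]"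
| "s_poly \<alpha> \<beta> \<sigma> (Suc (Suc n)) =
     [:- (lam \<alpha> \<beta> * real (Suc n) + shift \<alpha> \<beta> \<sigma>), 1:] * s_poly \<alpha> \<beta> \<sigma> (Suc n)
     - smult (\<sigma> * real (Suc n) + eta \<alpha> \<beta> * real (Suc n) * real n) (s_poly \<alpha> \<beta> \<sigma> n)"

definition s_fun :: "complex \<Rightarrow> complex \<Rightarrow> real \<Rightarrow> nat \<Rightarrow> real \<Rightarrow> complex" where
  "s_fun \<alpha> \<beta> \<sigma> n x = of_real (poly (s_poly \<alpha> \<beta> \<sigma> n) x)"


section \<open>The measures\<close>

definition gamma_measure :: "real \<Rightarrow> real \<Rightarrow> real measure" where
  "gamma_measure a \<sigma> =
     (let \<eta> = a\<^sup>2 in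
      density (restrict_space lborel {0<..})
        (\<lambda>x. ennreal (1 / Gamma (\<sigma> / \<eta>) * a powr (- \<sigma> / \<eta>)
                      * x powr (- 1 + \<sigma> / \<eta>) * exp (- x / a))))"

definition negbin_support :: "real \<Rightarrow> real \<Rightarrow> real set" where
  "negbin_support a b = range (\<lambda>n::nat. (a - b) * real n)"

text \<open>
  The sum of point masses at \<open>(a - b) n\<close>, as the image of a weighted counting measure on the
  naturals; the support carries its discrete sigma-algebra.
\<close>

definition negbin_measure :: "real \<Rightarrow> real \<Rightarrow> real \<Rightarrow> real measure" where
  "negbin_measure a b \<sigma> =
     (let \<eta> = a * b in
      distr
        (density (count_space (UNIV :: nat set))
          (\<lambda>n. ennreal ((1 - b / a) powr (\<sigma> / \<eta>)
                        * ((b / a) ^ n * (1 / fact n) * pochhammer (\<sigma> / \<eta>) n))))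
        (count_space (negbin_support a b))
        (\<lambda>n. (a - b) * real n))"

definition meixner_const :: "complex \<Rightarrow> real \<Rightarrow> real" where
  "meixner_const \<alpha> \<sigma> =
     (let \<eta> = eta \<alpha> (cnj \<alpha>) in
      (2 * cos (pi / 2 - Arg \<alpha>)) powr (\<sigma> / \<eta>) / (4 * Im \<alpha> * pi * Gamma (\<sigma> / \<eta>))
      * exp ((pi / 2 - Arg \<alpha>) * \<sigma> * Re \<alpha> / (Im \<alpha> * \<eta>)))"

definition meixner_measure :: "complex \<Rightarrow> real \<Rightarrow> real measure" where
  "meixner_measure \<alpha> \<sigma> =
     (let \<beta> = cnj \<alpha>; \<eta> = eta \<alpha> \<beta> in
      density lborel
        (\<lambda>x. ennreal (meixner_const \<alpha> \<sigma> * exp ((pi / 2 - Arg \<alpha>) * x / Im \<alpha>)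
              * (cmod (Gamma (\<i> * of_real x / (2 * of_real (Im \<alpha>))
                          + \<i> * of_real \<sigma> * \<beta> / (2 * of_real \<eta> * of_real (Im \<alpha>)))))\<^sup>2)))"

text \<open>The set \<open>X\<close> carrying the measure is \<open>space (mu \<alpha> \<beta> \<sigma>)\<close>, identified in the lemmas below.\<close>

definition mu :: "complex \<Rightarrow> complex \<Rightarrow> real \<Rightarrow> real measure" where
  "mu \<alpha> \<beta> \<sigma> =
     (if gamma_case \<alpha> \<beta> then gamma_measure (Re \<alpha>) \<sigma>
      else if negbin_case \<alpha> \<beta> then negbin_measure (Re \<alpha>) (Re \<beta>) \<sigma>
      else meixner_measure \<alpha> \<sigma>)"

lemma space_mu_gamma: "gamma_case \<alpha> \<beta> \<Longrightarrow> space (mu \<alpha> \<beta> \<sigma>) = {0<..}"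
  by (simp add: mu_def gamma_measure_def Let_def space_restrict_space)

lemma space_mu_negbin:
  "negbin_case \<alpha> \<beta> \<Longrightarrow> space (mu \<alpha> \<beta> \<sigma>) = negbin_support (Re \<alpha>) (Re \<beta>)"
  by (auto simp: mu_def negbin_measure_def Let_def gamma_case_def negbin_case_def)

lemma space_mu_meixner: "meixner_case \<alpha> \<beta> \<Longrightarrow> space (mu \<alpha> \<beta> \<sigma>) = UNIV"
  by (auto simp: mu_def meixner_measure_def Let_def gamma_case_def negbin_case_def
      meixner_case_def complex_is_Real_iff)


section \<open>The Hilbert spaces and the generalized Segal--Bargmann transform\<close>

text \<open>Elements of \<open>L2 M\<close> are representatives, not classes modulo almost everywhere equality.\<close>

definition L2 :: "real measure \<Rightarrow> (real \<Rightarrow> complex) set" where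
  "L2 M = {f \<in> borel_measurable M. integrable M (\<lambda>x. (cmod (f x))\<^sup>2)}"

definition L2_inner :: "real measure \<Rightarrow> (real \<Rightarrow> complex) \<Rightarrow> (real \<Rightarrow> complex) \<Rightarrow> complex" where
  "L2_inner M f g = (LINT x|M. f x * cnj (g x))"

definition taylor_coeff :: "(complex \<Rightarrow> complex) \<Rightarrow> nat \<Rightarrow> complex" where
  "taylor_coeff \<phi> n = (deriv ^^ n) \<phi> 0 / fact n"

definition Fock :: "real \<Rightarrow> real \<Rightarrow> (complex \<Rightarrow> complex) set" where
  "Fock \<eta> \<sigma> = {\<phi>. \<phi> holomorphic_on UNIV \<and>
      summable (\<lambda>n. (cmod (taylor_coeff \<phi> n))\<^sup>2 * (fact n * gfact \<sigma> (- \<eta>) n))}"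

definition Fock_inner ::
  "real \<Rightarrow> real \<Rightarrow> (complex \<Rightarrow> complex) \<Rightarrow> (complex \<Rightarrow> complex) \<Rightarrow> complex" where
  "Fock_inner \<eta> \<sigma> \<phi> \<psi> =
     (\<Sum>n. taylor_coeff \<phi> n * cnj (taylor_coeff \<psi> n) * of_real (fact n * gfact \<sigma> (- \<eta>) n))"

text \<open>
  A linear surjective isometry from the space of classes of \<open>L2 M\<close> onto the Fock space, given on
  representatives; the second clause says that it only depends on the class.
\<close>

definition unitary_L2_Fock ::
  "real measure \<Rightarrow> real \<Rightarrow> real \<Rightarrow> ((real \<Rightarrow> complex) \<Rightarrow> complex \<Rightarrow> complex) \<Rightarrow> bool" where
  "unitary_L2_Fock M \<eta> \<sigma> T \<longleftrightarrow>
     T ` L2 M = Fock \<eta> \<sigma> \<and>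
     (\<forall>f\<in>L2 M. \<forall>g\<in>L2 M. (AE x in M. f x = g x) \<longrightarrow> T f = T g) \<and>
     (\<forall>f\<in>L2 M. \<forall>g\<in>L2 M. T (\<lambda>x. f x + g x) = (\<lambda>z. T f z + T g z)) \<and>
     (\<forall>f\<in>L2 M. \<forall>c. T (\<lambda>x. c * f x) = (\<lambda>z. c * T f z)) \<and>
     (\<forall>f\<in>L2 M. \<forall>g\<in>L2 M. Fock_inner \<eta> \<sigma> (T f) (T g) = L2_inner M f g)"

definition segal_bargmann ::
  "complex \<Rightarrow> complex \<Rightarrow> real \<Rightarrow> ((real \<Rightarrow> complex) \<Rightarrow> complex \<Rightarrow> complex) \<Rightarrow> bool" where
  "segal_bargmann \<alpha> \<beta> \<sigma> T \<longleftrightarrow>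
     unitary_L2_Fock (mu \<alpha> \<beta> \<sigma>) (eta \<alpha> \<beta>) \<sigma> T \<and>
     (\<forall>n. T (s_fun \<alpha> \<beta> \<sigma> n) = (\<lambda>z. z ^ n))"


section \<open>The kernel\<close>

definition E_term :: "complex \<Rightarrow> complex \<Rightarrow> real \<Rightarrow> real \<Rightarrow> complex \<Rightarrow> nat \<Rightarrow> complex" where
  "E_term \<alpha> \<beta> \<sigma> x z n =
     z ^ n / of_real (fact n * gfact \<sigma> (- eta \<alpha> \<beta>) n) * s_fun \<alpha> \<beta> \<sigma> n x"

definition E_kernel :: "complex \<Rightarrow> complex \<Rightarrow> real \<Rightarrow> real \<Rightarrow> complex \<Rightarrow> complex" where
  "E_kernel \<alpha> \<beta> \<sigma> x z = (\<Sum>n. E_term \<alpha> \<beta> \<sigma> x z n)"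


section \<open>The complex-valued Poisson measure\<close>

text \<open>
  Integration against the complex measure \<open>exp (- \<zeta>) \<Sum>n. \<zeta>^n / n! \<delta>\<^sub>n\<close> is integration of the
  function times its density with respect to counting measure; integrability is with respect to
  the total variation measure.
\<close>

definition cpoisson_density :: "complex \<Rightarrow> nat \<Rightarrow> complex" where
  "cpoisson_density \<zeta> n = exp (- \<zeta>) * \<zeta> ^ n / fact n"

definition cpoisson_integrable :: "complex \<Rightarrow> (nat \<Rightarrow> complex) \<Rightarrow> bool" where
  "cpoisson_integrable \<zeta> g \<longleftrightarrow>
     integrable (count_space UNIV) (\<lambda>\<xi>. g \<xi> * cpoisson_density \<zeta> \<xi>)"

definition cpoisson_integral :: "complex \<Rightarrow> (nat \<Rightarrow> complex) \<Rightarrow> complex" where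
  "cpoisson_integral \<zeta> g = (LINT \<xi>|count_space UNIV. g \<xi> * cpoisson_density \<zeta> \<xi>)"

definition has_cpoisson_integral :: "complex \<Rightarrow> (nat \<Rightarrow> complex) \<Rightarrow> complex \<Rightarrow> bool" where
  "has_cpoisson_integral \<zeta> g I \<longleftrightarrow> cpoisson_integrable \<zeta> g \<and> I = cpoisson_integral \<zeta> g"

end

theory Submission
  imports Defs "HOL-Probability.Sinc_Integral" "HOL-Real_Asymp.Real_Asymp"
begin

text \<open>
  Put \<open>y = x - l + \<sigma> / \<beta>\<close> and \<open>G k = (\<Prod>j<k. \<beta> (y + j (\<alpha> - \<beta>)) / (\<sigma> + j \<eta>))\<close>. Checking the three-term
  recurrence shows that \<open>(- \<beta>)\<^sup>n s\<^sub>n / (\<sigma> | - \<eta>)\<^sub>n\<close> is the binomial transform of \<open>(-1)\<^sup>k G k\<close>, in all three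
  cases at once. Multiplying the absolutely convergent series \<open>\<Sum>k. (z / \<beta>)\<^sup>k G k / k!\<close> with that of
  \<open>exp (- z / \<beta>)\<close> therefore gives the kernel: it converges for every \<open>x\<close> and is a Poisson integral of \<open>G\<close>.

  Unitarity of the transform makes the \<open>s\<^sub>n\<close> orthogonal with norms \<open>n! (\<sigma> | - \<eta>)\<^sub>n\<close>, provided that
  they lie in L2. By Fatou's lemma the pointwise sum of the kernel is then also its L2 sum, and
  integrating \<open>f\<close> against it termwise yields the Taylor series of the transform of \<open>f\<close>.

  In the Meixner case the moments are finite because \<open>|\<Gamma>(a + i y)| / \<Gamma>(a)\<close> increases with \<open>a\<close> by
  Euler's product, while at integer \<open>a\<close> the reflection formula gives decay like \<open>exp (- \<pi> |y| / 2)\<close>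
  up to powers of \<open>y\<close>.
\<close>

section \<open>The orthogonal polynomials and the Poisson integrals\<close>

text \<open>Pascal's rule makes the transform \<open>D\<close> of the shifted sequence the forward
  difference of \<open>T\<close>. Absorption identities trade the factor n outside a binomial sum
  for the factor k inside, so the first-order recurrence of \<open>h\<close> becomes a relation
  between \<open>D n\<close>, \<open>T n\<close> and \<open>D (n - 1)\<close>, hence a three-term
  recurrence for \<open>T\<close>.\<close>

lemma binomial_transform_recurrence:
  fixes h T :: "nat \<Rightarrow> 'a::comm_ring_1"
  assumes T: "\<And>n. T n = (\<Sum>k\<le>n. of_nat (n choose k) * h k)"
    and h: "\<And>k. (\<sigma> + of_nat k * (\<alpha> * \<beta>)) * h (Suc k) = - (\<beta> * (y + of_nat k * (\<alpha> - \<beta>))) * h k"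
  shows "\<sigma> * T (Suc 0) = (\<sigma> - \<beta> * y) * T 0"
    and "(\<sigma> + of_nat (Suc m) * (\<alpha> * \<beta>)) * T (Suc (Suc m)) =
      (\<sigma> - \<beta> * y + \<beta> * (\<alpha> + \<beta>) * of_nat (Suc m)) * T (Suc m) - of_nat (Suc m) * \<beta>\<^sup>2 * T m"
proof -
  show "\<sigma> * T (Suc 0) = (\<sigma> - \<beta> * y) * T 0"
    using h[of 0] by (simp add: T algebra_simps)
  define D where "D n = (\<Sum>k\<le>n. of_nat (n choose k) * h (Suc k))" for n
  have T_Suc: "T (Suc n) = T n + D n" for n
  proof -
    have "T (Suc n) = h 0 + (\<Sum>k\<le>n. of_nat ((n choose k) + (n choose Suc k)) * h (Suc k))"
      unfolding T sum.atMost_Suc_shift by simp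
    also have "\<dots> = (h 0 + (\<Sum>k\<le>n. of_nat (n choose Suc k) * h (Suc k))) + D n"
      by (simp add: D_def sum.distrib algebra_simps)
    also have "h 0 + (\<Sum>k\<le>n. of_nat (n choose Suc k) * h (Suc k))
      = (\<Sum>k\<le>Suc n. of_nat (n choose k) * h k)"
      unfolding sum.atMost_Suc_shift by simp
    also have "\<dots> = (\<Sum>k\<le>n. of_nat (n choose k) * h k)" by (simp add: binomial_eq_0)
    also have "\<dots> = T n" by (simp add: T)
    finally show ?thesis .
  qed
  \<comment> \<open>Absorption: summing row n + 1 with the extra weight k lowers the row by one and
    leaves only the factor n + 1.\<close>
  have D1: "of_nat (Suc n) * D n = (\<Sum>k\<le>Suc n. of_nat k * (of_nat (Suc n choose k) * h k))" for n
  proof -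
    have "of_nat (Suc n) * D n = (\<Sum>k\<le>n. of_nat (Suc n * (n choose k)) * h (Suc k))"
      by (simp only: D_def sum_distrib_left of_nat_mult mult.assoc)
    also have "\<dots> = (\<Sum>k\<le>n. of_nat (Suc k) * (of_nat (Suc n choose Suc k) * h (Suc k)))"
      by (simp only: Suc_times_binomial_eq mult.commute[of "Suc n choose Suc k" for k] of_nat_mult mult.assoc)
    finally show ?thesis unfolding sum.atMost_Suc_shift by simp
  qed
  \<comment> \<open>The factor n moves inside as k, at the price of an extra \<open>h k\<close>; an
    index shift in the last term of the identity below produces it.\<close>
  have D2: "of_nat n * D n = (\<Sum>k\<le>n. of_nat (n choose k) * (of_nat k * (h (Suc k) + h k)))" for n
  proof -
    have *: "n * (n choose k) = k * (n choose k) + Suc k * (n choose Suc k)" if "k \<le> n" for k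
    proof -
      have "Suc k * (n choose Suc k) = (n - k) * (n choose k)"
        by (metis binomial_absorb_comp binomial_absorption mult.commute)
      then show ?thesis using that
        by (metis add_mult_distrib le_add_diff_inverse)
    qed
    have "of_nat n * D n = (\<Sum>k\<le>n. of_nat (n * (n choose k)) * h (Suc k))"
      by (simp only: D_def sum_distrib_left of_nat_mult mult.assoc)
    also have "\<dots> = (\<Sum>k\<le>n. of_nat (k * (n choose k) + Suc k * (n choose Suc k)) * h (Suc k))"
      by (intro sum.cong refl) (simp only: * atMost_iff)
    also have "\<dots> = (\<Sum>k\<le>n. of_nat (n choose k) * (of_nat k * h (Suc k)))
        + (\<Sum>k\<le>n. of_nat (Suc k) * (of_nat (n choose Suc k) * h (Suc k)))"
      by (simp add: sum.distrib algebra_simps)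
    also have "(\<Sum>k\<le>n. of_nat (Suc k) * (of_nat (n choose Suc k) * h (Suc k)))
        = (\<Sum>k\<le>Suc n. of_nat k * (of_nat (n choose k) * h k))"
      unfolding sum.atMost_Suc_shift by simp
    finally show ?thesis by (simp add: binomial_eq_0 sum.distrib algebra_simps)
  qed
  \<comment> \<open>With k in place of n inside the sum, the recurrence of \<open>h\<close> applies
    termwise. The terms in y and \<alpha>\<beta>k cancel, \<open>\<beta>\<^sup>2 * k * h k\<close>
    survives, and \<open>D1\<close> turns its sum into a multiple of the previous
    \<open>D\<close>.\<close>
  have "(\<sigma> + of_nat n * (\<alpha> * \<beta>)) * D n + \<beta> * y * T n
      = \<beta>\<^sup>2 * (\<Sum>k\<le>n. of_nat k * (of_nat (n choose k) * h k))" for n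
  proof -
    have "(\<sigma> + of_nat n * (\<alpha> * \<beta>)) * D n + \<beta> * y * T n
      = (\<Sum>k\<le>n. of_nat (n choose k) *
          ((\<sigma> + of_nat k * (\<alpha> * \<beta>)) * h (Suc k) + \<alpha> * \<beta> * of_nat k * h k + \<beta> * y * h k))"
      using D2[of n]
      by (simp add: distrib_right mult.commute[of "of_nat n" "\<alpha> * \<beta>"] mult.assoc[of "\<alpha> * \<beta>"] del: mult.assoc)
         (simp add: D_def T sum_distrib_left sum.distrib algebra_simps)
    also have "\<dots> = (\<Sum>k\<le>n. \<beta>\<^sup>2 * (of_nat k * (of_nat (n choose k) * h k)))"
      unfolding h by (intro sum.cong refl) (simp add: algebra_simps power2_eq_square)
    finally show ?thesis by (simp add: sum_distrib_left)
  qed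
  from this[of "Suc m"] D1[of m]
  have "(\<sigma> + of_nat (Suc m) * (\<alpha> * \<beta>)) * D (Suc m) + \<beta> * y * T (Suc m)
      = \<beta>\<^sup>2 * (of_nat (Suc m) * D m)" by simp
  with T_Suc[of m] T_Suc[of "Suc m"]
  show "(\<sigma> + of_nat (Suc m) * (\<alpha> * \<beta>)) * T (Suc (Suc m)) =
      (\<sigma> - \<beta> * y + \<beta> * (\<alpha> + \<beta>) * of_nat (Suc m)) * T (Suc m) - of_nat (Suc m) * \<beta>\<^sup>2 * T m"
    by (simp del: of_nat_Suc) (simp del: of_nat_Suc add: algebra_simps power2_eq_square)
qed

lemma
  assumes "gamma_case \<alpha> \<beta> \<or> negbin_case \<alpha> \<beta> \<or> meixner_case \<alpha> \<beta>"
  shows of_real_lam: "of_real (lam \<alpha> \<beta>) = \<alpha> + \<beta>"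
    and of_real_eta: "of_real (eta \<alpha> \<beta>) = \<alpha> * \<beta>"
    and eta_pos: "0 < eta \<alpha> \<beta>"
proof -
  show "of_real (lam \<alpha> \<beta>) = \<alpha> + \<beta>" "of_real (eta \<alpha> \<beta>) = \<alpha> * \<beta>"
    using assms by (auto simp: gamma_case_def negbin_case_def meixner_case_def complex_is_Real_iff
        lam_def eta_def complex_eq_iff)
  have "0 < Re \<alpha> * Re \<alpha> + Im \<alpha> * Im \<alpha>" if "Im \<alpha> > 0"
    using that by (intro add_nonneg_pos) auto
  then show "0 < eta \<alpha> \<beta>"
    using assms by (auto simp: gamma_case_def negbin_case_def meixner_case_def complex_is_Real_iff
        eta_def)
qed

lemma gfact_pos:
  assumes "0 < \<sigma>" "0 \<le> \<eta>"
  shows "0 < gfact \<sigma> (- \<eta> :: real) n"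
  unfolding gfact_def using assms by (intro prod_pos) (auto intro: add_pos_nonneg)

lemma gfact_Suc: "gfact \<sigma> (- \<eta>) (Suc n) = gfact \<sigma> (- \<eta>) n * (\<sigma> + of_nat n * \<eta>)"
  by (simp add: gfact_def)

text \<open>
  Since \<open>(\<sigma> + j \<eta>) / \<beta> = \<alpha> (\<sigma> / \<eta> + j)\<close>, this is
  \<open>(1 - \<beta> / \<alpha>)\<^sup>k (y / (\<alpha> - \<beta>))\<^sup>(\<^sup>k\<^sup>) / (\<sigma> / \<eta>)\<^sup>(\<^sup>k\<^sup>)\<close> when \<open>\<alpha> \<noteq> \<beta>\<close>, with the limit
  \<open>(y / \<alpha>)\<^sup>k / (\<sigma> / \<eta>)\<^sup>(\<^sup>k\<^sup>)\<close> at \<open>\<alpha> = \<beta>\<close>; here \<open>y = x - l + \<sigma> / \<beta>\<close>.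
\<close>
definition poisson_integrand :: "complex \<Rightarrow> complex \<Rightarrow> real \<Rightarrow> real \<Rightarrow> nat \<Rightarrow> complex" where
  "poisson_integrand \<alpha> \<beta> \<sigma> x k =
     (\<Prod>j<k. \<beta> * (of_real (x - shift \<alpha> \<beta> \<sigma>) + of_real \<sigma> / \<beta> + of_nat j * (\<alpha> - \<beta>))
            / (of_real \<sigma> + of_nat j * of_real (eta \<alpha> \<beta>)))"

text \<open>Induction over two predecessors: after multiplication by \<open>(- \<beta>) ^ n\<close>
  and division by (\<sigma> | -\<eta>)_n, the recurrence defining \<open>s_poly\<close> is the one
  that \<open>binomial_transform_recurrence\<close> gives for the sum, with the same initial
  values.\<close>

lemma s_fun_eq_binomial_sum:
  assumes "0 < \<sigma>" and case_assm: "gamma_case \<alpha> \<beta> \<or> negbin_case \<alpha> \<beta> \<or> meixner_case \<alpha> \<beta>"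
  shows "(- \<beta>) ^ n * s_fun \<alpha> \<beta> \<sigma> n x = of_real (gfact \<sigma> (- eta \<alpha> \<beta>) n) *
    (\<Sum>k\<le>n. of_nat (n choose k) * ((-1) ^ k * poisson_integrand \<alpha> \<beta> \<sigma> x k))"
proof -
  define \<eta> where "\<eta> = eta \<alpha> \<beta>"
  define h where "h k = (-1) ^ k * poisson_integrand \<alpha> \<beta> \<sigma> x k" for k
  define T where "T n = (\<Sum>k\<le>n. of_nat (n choose k) * h k)" for n
  define A :: "nat \<Rightarrow> complex" where "A n = of_real (gfact \<sigma> (- \<eta>) n)" for n
  define y where "y = of_real (x - shift \<alpha> \<beta> \<sigma>) + of_real \<sigma> / \<beta>"
  note eta = of_real_eta[OF case_assm, folded \<eta>_def] and lam = of_real_lam[OF case_assm]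
  have \<eta>: "\<eta> > 0" unfolding \<eta>_def by (rule eta_pos) fact
  with eta have \<beta>: "\<beta> \<noteq> 0" by auto
  have pos: "\<sigma> + real k * \<eta> \<noteq> 0" for k using \<eta> \<open>0 < \<sigma>\<close> by (smt (verit) mult_nonneg_nonneg of_nat_0_le_iff)
  have nz: "of_real \<sigma> + of_nat k * (\<alpha> * \<beta>) \<noteq> 0" for k
  proof -
    have "of_real \<sigma> + of_nat k * (\<alpha> * \<beta>) = of_real (\<sigma> + real k * \<eta>)"
      by (simp add: eta)
    then show ?thesis using pos[of k] by (simp only: of_real_eq_0_iff not_False_eq_True)
  qed
  have hrec: "(of_real \<sigma> + of_nat k * (\<alpha> * \<beta>)) * h (Suc k) = - (\<beta> * (y + of_nat k * (\<alpha> - \<beta>))) * h k" for k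
    using nz[of k] by (simp add: h_def poisson_integrand_def y_def eta \<eta>_def[symmetric])
  note rec = binomial_transform_recurrence[OF T_def hrec]
  have A_Suc: "A (Suc k) = A k * (of_real \<sigma> + of_nat k * (\<alpha> * \<beta>))" for k
    by (simp add: A_def gfact_Suc eta)
  \<comment> \<open>The offset \<sigma> / \<beta> in \<open>y\<close> is chosen for this identity:
    it makes -\<beta> s_1 equal to \<sigma> - \<beta> y, as the initial relation for
    \<open>T\<close> demands.\<close>
  have xy: "\<beta> * (of_real x - of_real (shift \<alpha> \<beta> \<sigma>)) = \<beta> * y - of_real \<sigma>"
    using \<beta> by (simp add: y_def field_simps)
  have "(- \<beta>) ^ n * s_fun \<alpha> \<beta> \<sigma> n x = A n * T n"
  proof (induction n rule: induct_nat_012)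
    case 0
    show ?case by (simp add: s_fun_def A_def gfact_def T_def h_def poisson_integrand_def)
  next
    case 1
    have "T 0 = 1" by (simp add: T_def h_def poisson_integrand_def)
    then show ?case using rec(1) xy by (simp add: s_fun_def A_Suc) (simp add: A_def gfact_def algebra_simps)
  next
    case (ge2 n)
    have s: "s_fun \<alpha> \<beta> \<sigma> (Suc (Suc n)) x =
       (of_real x - of_real (shift \<alpha> \<beta> \<sigma>) - (\<alpha> + \<beta>) * of_nat (Suc n)) * s_fun \<alpha> \<beta> \<sigma> (Suc n) x
       - of_nat (Suc n) * (of_real \<sigma> + of_nat n * (\<alpha> * \<beta>)) * s_fun \<alpha> \<beta> \<sigma> n x"
      unfolding s_fun_def s_poly.simps lam[symmetric] eta[symmetric]
      by (simp add: \<eta>_def algebra_simps)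
    have "(- \<beta>) ^ Suc (Suc n) * s_fun \<alpha> \<beta> \<sigma> (Suc (Suc n)) x =
       - (\<beta> * (of_real x - of_real (shift \<alpha> \<beta> \<sigma>)) - \<beta> * (\<alpha> + \<beta>) * of_nat (Suc n)) * ((- \<beta>) ^ Suc n * s_fun \<alpha> \<beta> \<sigma> (Suc n) x)
       - \<beta>\<^sup>2 * of_nat (Suc n) * (of_real \<sigma> + of_nat n * (\<alpha> * \<beta>)) * ((- \<beta>) ^ n * s_fun \<alpha> \<beta> \<sigma> n x)"
      unfolding s power_Suc by algebra
    also have "\<dots> = A (Suc n) * ((of_real \<sigma> - \<beta> * y + \<beta> * (\<alpha> + \<beta>) * of_nat (Suc n)) * T (Suc n) - of_nat (Suc n) * \<beta>\<^sup>2 * T n)"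
      unfolding ge2.IH xy A_Suc by algebra
    also have "\<dots> = A (Suc (Suc n)) * T (Suc (Suc n))"
      unfolding rec(2)[symmetric] by (simp add: A_Suc)
    finally show ?case .
  qed
  then show ?thesis by (simp add: A_def T_def h_def \<eta>_def)
qed

text \<open>All factors of the product share one bound, being quotients of affine functions of j
  with denominator \<sigma> + j \<eta>. Such geometric growth is beaten by the k! in the Poisson
  weights.\<close>

lemma norm_poisson_integrand_le:
  assumes "0 < \<sigma>" and case_assm: "gamma_case \<alpha> \<beta> \<or> negbin_case \<alpha> \<beta> \<or> meixner_case \<alpha> \<beta>"
  shows "\<exists>C. \<forall>k. cmod (poisson_integrand \<alpha> \<beta> \<sigma> x k) \<le> C ^ k"
proof -
  define \<eta> where "\<eta> = eta \<alpha> \<beta>"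
  have \<eta>: "\<eta> > 0" unfolding \<eta>_def by (rule eta_pos) fact
  define y where "y = of_real (x - shift \<alpha> \<beta> \<sigma>) + of_real \<sigma> / \<beta>"
  \<comment> \<open>The two parts of the numerator are bounded separately: |y| against \<sigma>, and
    j |\<alpha> - \<beta>| against j \<eta>.\<close>
  define C where "C = cmod \<beta> * (cmod y / \<sigma> + cmod (\<alpha> - \<beta>) / \<eta>)"
  have fac: "cmod (\<beta> * (y + of_nat j * (\<alpha> - \<beta>)) / (of_real \<sigma> + of_nat j * of_real \<eta>)) \<le> C" for j
  proof -
    have p: "0 < \<sigma> + real j * \<eta>" using \<eta> \<open>0 < \<sigma>\<close> by (intro add_pos_nonneg) auto
    have "cmod (of_real \<sigma> + of_nat j * of_real \<eta>) = cmod (of_real (\<sigma> + real j * \<eta>))" by simp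
    also have "\<dots> = \<sigma> + real j * \<eta>" using p by (simp only: norm_of_real)
    finally have n: "cmod (of_real \<sigma> + of_nat j * of_real \<eta>) = \<sigma> + real j * \<eta>" .
    have "cmod (y + of_nat j * (\<alpha> - \<beta>)) \<le> cmod y + real j * cmod (\<alpha> - \<beta>)"
      by (rule order_trans[OF norm_triangle_ineq]) (simp add: norm_mult)
    also have "\<dots> \<le> (cmod y / \<sigma> + cmod (\<alpha> - \<beta>) / \<eta>) * (\<sigma> + real j * \<eta>)"
      using \<eta> \<open>0 < \<sigma>\<close> by (simp add: field_simps)
    finally show ?thesis
      using p unfolding norm_divide norm_mult n C_def
      by (simp add: divide_le_eq mult.assoc mult_left_mono)
  qed
  have "cmod (poisson_integrand \<alpha> \<beta> \<sigma> x k) \<le> C ^ k" for k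
    unfolding poisson_integrand_def prod_norm[symmetric] y_def[symmetric] \<eta>_def[symmetric]
    using prod_mono[of "{..<k}" "\<lambda>j. cmod (\<beta> * (y + of_nat j * (\<alpha> - \<beta>)) / (of_real \<sigma> + of_nat j * of_real \<eta>))" "\<lambda>_. C"] fac
    by simp
  then show ?thesis by blast
qed

text \<open>A Cauchy product with the series of exp(-z / \<beta>): by
  \<open>s_fun_eq_binomial_sum\<close> its coefficients are the kernel terms, while the product of
  the two sums is the Poisson integral.\<close>

lemma E_term_sums_cpoisson:
  assumes "0 < \<sigma>" and case_assm: "gamma_case \<alpha> \<beta> \<or> negbin_case \<alpha> \<beta> \<or> meixner_case \<alpha> \<beta>"
  shows "summable (E_term \<alpha> \<beta> \<sigma> x z)"
    and "has_cpoisson_integral (z / \<beta>) (poisson_integrand \<alpha> \<beta> \<sigma> x) (E_kernel \<alpha> \<beta> \<sigma> x z)"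
proof -
  define G where "G = poisson_integrand \<alpha> \<beta> \<sigma> x"
  define \<zeta> where "\<zeta> = z / \<beta>"
  define c where "c k = G k * \<zeta> ^ k / fact k" for k
  define b where "b k = (- \<zeta>) ^ k / fact k" for k
  have \<eta>: "eta \<alpha> \<beta> > 0" by (rule eta_pos) fact
  with of_real_eta[OF case_assm] have \<beta>: "\<beta> \<noteq> 0" by auto
  obtain C where C: "\<And>k. cmod (G k) \<le> C ^ k"
    using norm_poisson_integrand_le[OF assms, of x] unfolding G_def by blast
  have c: "summable (\<lambda>k. norm (c k))"
  proof (rule summable_comparison_test')
    show "summable (\<lambda>k. inverse (fact k) * (C * cmod \<zeta>) ^ k)" by (rule summable_exp)
    show "norm (norm (c k)) \<le> inverse (fact k) * (C * cmod \<zeta>) ^ k" if "k \<ge> 0" for k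
      using mult_right_mono[OF C[of k], of "cmod \<zeta> ^ k"]
      by (simp add: c_def norm_mult norm_divide norm_power power_mult_distrib field_simps)
  qed
  have b: "summable (\<lambda>k. norm (b k))"
    using summable_norm_exp[of "- \<zeta>"] by (simp add: b_def norm_mult norm_inverse divide_inverse mult.commute)
  have b_sum: "(\<Sum>k. b k) = exp (- \<zeta>)"
    by (simp add: exp_def b_def scaleR_conv_of_real divide_inverse mult.commute)
  \<comment> \<open>Here (n choose k) / n! = 1 / (k! (n - k)!), and the signs match because
    \<open>(- \<zeta>) ^ n\<close> splits as
    \<open>(-1) ^ k * \<zeta> ^ k * (- \<zeta>) ^ (n - k)\<close>.\<close>
  have "(\<Sum>i\<le>n. c i * b (n - i)) = E_term \<alpha> \<beta> \<sigma> x z n" for n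
  proof -
    have pos: "gfact \<sigma> (- eta \<alpha> \<beta>) n \<noteq> 0" using gfact_pos[of \<sigma> "eta \<alpha> \<beta>" n] \<open>0 < \<sigma>\<close> \<eta> by simp
    have "s_fun \<alpha> \<beta> \<sigma> n x = of_real (gfact \<sigma> (- eta \<alpha> \<beta>) n) *
        (\<Sum>k\<le>n. of_nat (n choose k) * ((-1) ^ k * G k)) / (- \<beta>) ^ n"
      using s_fun_eq_binomial_sum[OF assms, of n x] \<beta> by (simp add: field_simps G_def)
    moreover have "(- \<zeta>) ^ n = z ^ n / (- \<beta>) ^ n"
      by (metis \<zeta>_def minus_divide_right power_divide)
    ultimately have "E_term \<alpha> \<beta> \<sigma> x z n = (- \<zeta>) ^ n / fact n * (\<Sum>k\<le>n. of_nat (n choose k) * ((-1) ^ k * G k))"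
      using pos unfolding E_term_def by simp
    also have "\<dots> = (\<Sum>i\<le>n. c i * b (n - i))"
      unfolding sum_distrib_left
    proof (intro sum.cong refl)
      fix k assume "k \<in> {..n}"
      then have k: "k \<le> n" by simp
      have "(- \<zeta>) ^ n = (-1) ^ k * \<zeta> ^ k * (- \<zeta>) ^ (n - k)"
        by (metis k le_add_diff_inverse power_add power_minus)
      moreover have "(-1) ^ k * (-1) ^ k = (1 :: complex)" by (simp flip: power_mult_distrib)
      ultimately show "(- \<zeta>) ^ n / fact n * (of_nat (n choose k) * ((-1) ^ k * G k)) = c k * b (n - k)"
        using k by (simp add: binomial_fact c_def b_def field_simps)
    qed
    finally show ?thesis by simp
  qed
  then have sums: "E_term \<alpha> \<beta> \<sigma> x z sums ((\<Sum>k. c k) * exp (- \<zeta>))"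
    using Cauchy_product_sums[OF c b] b_sum by simp
  then show "summable (E_term \<alpha> \<beta> \<sigma> x z)" by (simp add: sums_iff)
  \<comment> \<open>Up to the constant exp(-\<zeta>) the integrand times the density is
    \<open>c\<close>, so absolute convergence of its series is integrability.\<close>
  have dens: "G \<xi> * cpoisson_density \<zeta> \<xi> = c \<xi> * exp (- \<zeta>)" for \<xi>
    by (simp add: cpoisson_density_def c_def)
  have int: "integrable (count_space UNIV) (\<lambda>\<xi>. G \<xi> * cpoisson_density \<zeta> \<xi>)"
    unfolding integrable_count_space_nat_iff dens norm_mult by (intro summable_mult2 c)
  have "(\<Sum>k. c k * exp (- \<zeta>)) = (\<Sum>k. c k) * exp (- \<zeta>)"
    by (rule suminf_mult2[symmetric]) (rule summable_norm_cancel[OF c])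
  with integral_count_space_nat[OF int] sums
  have "E_kernel \<alpha> \<beta> \<sigma> x z = cpoisson_integral \<zeta> G"
    by (simp add: E_kernel_def cpoisson_integral_def dens sums_iff)
  with int show "has_cpoisson_integral (z / \<beta>) (poisson_integrand \<alpha> \<beta> \<sigma> x) (E_kernel \<alpha> \<beta> \<sigma> x z)"
    by (simp add: has_cpoisson_integral_def cpoisson_integrable_def G_def \<zeta>_def)
qed

section \<open>Closed forms of the integrand in the three cases\<close>

text \<open>With \<alpha> = \<beta> the numerators no longer depend on j, and l cancels against
  \<sigma> / \<beta>, leaving \<alpha> x in every factor.\<close>

lemma poisson_integrand_gamma:
  assumes "gamma_case \<alpha> \<beta>" "0 < \<sigma>"
  shows "poisson_integrand \<alpha> \<beta> \<sigma> x =
    (\<lambda>\<xi>. inverse (pochhammer (of_real (\<sigma> / eta \<alpha> \<beta>)) \<xi>) * (of_real x / \<alpha>) ^ \<xi>)"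
proof
  fix k
  note case_assm = disjI1[OF assms(1)]
  note eta = of_real_eta[OF case_assm]
  have "\<alpha> \<noteq> 0" "\<beta> = \<alpha>" and nm: "\<not> meixner_case \<alpha> \<beta>" and \<alpha>: "of_real (Re \<alpha>) = \<alpha>"
    using assms(1) by (auto simp: gamma_case_def meixner_case_def complex_is_Real_iff complex_eq_iff)
  have "poisson_integrand \<alpha> \<beta> \<sigma> x k = (\<Prod>j<k. inverse (of_real (\<sigma> / eta \<alpha> \<beta>) + of_nat j) * (of_real x / \<alpha>))"
    unfolding poisson_integrand_def
  proof (intro prod.cong refl)
    fix j
    have *: "of_real \<sigma> + of_nat j * of_real (eta \<alpha> \<beta>) = \<alpha> * \<alpha> * (of_real (\<sigma> / eta \<alpha> \<beta>) + of_nat j)"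
      using \<open>\<alpha> \<noteq> 0\<close> \<open>\<beta> = \<alpha>\<close> by (simp add: eta[unfolded \<open>\<beta> = \<alpha>\<close>] of_real_divide algebra_simps)
    have **: "\<beta> * (of_real (x - shift \<alpha> \<beta> \<sigma>) + of_real \<sigma> / \<beta> + of_nat j * (\<alpha> - \<beta>)) = \<alpha> * of_real x"
      using nm \<alpha> \<open>\<beta> = \<alpha>\<close> by (simp add: shift_def)
    show "\<beta> * (of_real (x - shift \<alpha> \<beta> \<sigma>) + of_real \<sigma> / \<beta> + of_nat j * (\<alpha> - \<beta>)) /
      (of_real \<sigma> + of_nat j * of_real (eta \<alpha> \<beta>)) = inverse (of_real (\<sigma> / eta \<alpha> \<beta>) + of_nat j) * (of_real x / \<alpha>)"
      unfolding * ** using \<open>\<alpha> \<noteq> 0\<close> by (simp add: divide_inverse)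
  qed
  then show "poisson_integrand \<alpha> \<beta> \<sigma> x k =
     inverse (pochhammer (of_real (\<sigma> / eta \<alpha> \<beta>)) k) * (of_real x / \<alpha>) ^ k"
    by (simp only: prod.distrib pochhammer_prod prod_inversef[symmetric] atLeast0LessThan o_def
        prod_constant card_lessThan)
qed

text \<open>Serves the negative binomial and Meixner cases together: \<alpha> - \<beta> is pulled
  out of each numerator and \<alpha>\<beta> out of each denominator.\<close>

lemma poisson_integrand_pochhammer:
  assumes "\<alpha> \<noteq> \<beta>" "\<alpha> \<noteq> 0" "\<beta> \<noteq> 0" "of_real (eta \<alpha> \<beta>) = \<alpha> * \<beta>"
  shows "poisson_integrand \<alpha> \<beta> \<sigma> x \<xi> = (1 - \<beta> / \<alpha>) ^ \<xi>
    * inverse (pochhammer (of_real (\<sigma> / eta \<alpha> \<beta>)) \<xi>)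
    * pochhammer ((of_real (x - shift \<alpha> \<beta> \<sigma>) + of_real \<sigma> / \<beta>) / (\<alpha> - \<beta>)) \<xi>"
proof -
  define y where "y = of_real (x - shift \<alpha> \<beta> \<sigma>) + of_real \<sigma> / \<beta>"
  have "poisson_integrand \<alpha> \<beta> \<sigma> x \<xi>
      = (\<Prod>j<\<xi>. (1 - \<beta> / \<alpha>) * inverse (of_real (\<sigma> / eta \<alpha> \<beta>) + of_nat j) * (y / (\<alpha> - \<beta>) + of_nat j))"
    unfolding poisson_integrand_def y_def[symmetric]
  proof (intro prod.cong refl)
    fix j
    have *: "of_real \<sigma> + of_nat j * of_real (eta \<alpha> \<beta>) = \<alpha> * \<beta> * (of_real (\<sigma> / eta \<alpha> \<beta>) + of_nat j)"
      using assms by (simp add: of_real_divide algebra_simps)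
    have **: "y + of_nat j * (\<alpha> - \<beta>) = (\<alpha> - \<beta>) * (y / (\<alpha> - \<beta>) + of_nat j)"
      using assms(1) by (simp add: field_simps)
    have ***: "1 - \<beta> / \<alpha> = (\<alpha> - \<beta>) / \<alpha>" using assms(2) by (simp add: field_simps)
    show "\<beta> * (y + of_nat j * (\<alpha> - \<beta>)) / (of_real \<sigma> + of_nat j * of_real (eta \<alpha> \<beta>)) =
      (1 - \<beta> / \<alpha>) * inverse (of_real (\<sigma> / eta \<alpha> \<beta>) + of_nat j) * (y / (\<alpha> - \<beta>) + of_nat j)"
      unfolding * ** *** using assms by (simp add: divide_inverse mult_ac)
  qed
  then show ?thesis
    by (simp add: prod.distrib pochhammer_prod prod_inversef[symmetric] atLeast0LessThan y_def)
qed

text \<open>Both sides equal \<open>pochhammer r (n + k)\<close>. This lets the lattice point and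
  the Poisson variable exchange roles in the negative binomial case.\<close>

lemma pochhammer_of_nat_shift:
  fixes r :: "'a::field_char_0"
  shows "pochhammer r n * pochhammer (r + of_nat n) k = pochhammer r k * pochhammer (r + of_nat k) n"
  using pochhammer_product'[of r n k] pochhammer_product'[of r k n] by (simp add: add.commute)

lemma gfact_eq_pochhammer: "gfact (\<eta> * r) (- \<eta>) n = \<eta> ^ n * pochhammer r n"
  for r :: real
proof -
  have "\<eta> * r - real k * - \<eta> = \<eta> * (r + real k)" for k by (simp add: algebra_simps)
  then show ?thesis by (simp add: gfact_def pochhammer_prod atLeast0LessThan prod.distrib)
qed

text \<open>Since l = \<sigma> / \<alpha>, the argument y / (\<alpha> - \<beta>) at the lattice
  point is \<sigma> / \<eta> + n; \<open>pochhammer_of_nat_shift\<close> then replaces rising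
  factorials of length \<xi> by ones of length n.\<close>

lemma poisson_integrand_negbin:
  assumes "negbin_case \<alpha> \<beta>" "0 < \<sigma>"
  shows "poisson_integrand \<alpha> \<beta> \<sigma> ((Re \<alpha> - Re \<beta>) * real n) =
    (\<lambda>\<xi>. (1 - \<beta> / \<alpha>) ^ \<xi> * of_real (gfact (real \<xi> * eta \<alpha> \<beta> + \<sigma>) (- eta \<alpha> \<beta>) n
                                     / gfact \<sigma> (- eta \<alpha> \<beta>) n))"
proof
  fix k
  note case_assm = disjI2[OF disjI1[OF assms(1)]]
  note eta = of_real_eta[OF case_assm] and pos = eta_pos[OF case_assm]
  define \<eta> where "\<eta> = eta \<alpha> \<beta>"
  define r where "r = \<sigma> / \<eta>"
  have r: "r > 0" "\<sigma> = \<eta> * r" using pos assms(2) by (auto simp: r_def \<eta>_def)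
  have nz: "\<alpha> \<noteq> 0" "\<beta> \<noteq> 0" "\<alpha> \<noteq> \<beta>" and nm: "\<not> meixner_case \<alpha> \<beta>"
    and re: "of_real (Re \<alpha>) = \<alpha>" "of_real (Re \<beta>) = \<beta>"
    using assms(1) by (auto simp: negbin_case_def meixner_case_def complex_is_Real_iff complex_eq_iff)
  have "(of_real ((Re \<alpha> - Re \<beta>) * real n - shift \<alpha> \<beta> \<sigma>) + of_real \<sigma> / \<beta>) / (\<alpha> - \<beta>) = of_real r + of_nat n"
  proof -
    have "of_real \<sigma> = \<alpha> * \<beta> * of_real r"
      using r(2) eta by (simp add: \<eta>_def)
    then show ?thesis
      using nm nz by (simp add: shift_def re of_real_divide field_simps)
  qed
  moreover have "pochhammer (r + real n) k / pochhammer r k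
      = gfact (real k * \<eta> + \<sigma>) (- \<eta>) n / gfact \<sigma> (- \<eta>) n"
  proof -
    have "real k * \<eta> + \<sigma> = \<eta> * (r + real k)" by (simp add: r(2) algebra_simps)
    then have "gfact (real k * \<eta> + \<sigma>) (- \<eta>) n / gfact \<sigma> (- \<eta>) n = pochhammer (r + real k) n / pochhammer r n"
      using pos by (simp add: r(2) gfact_eq_pochhammer \<eta>_def)
    moreover have "pochhammer (r + real n) k / pochhammer r k = pochhammer (r + real k) n / pochhammer r n"
      using pochhammer_of_nat_shift[of r n k] pochhammer_pos[OF r(1), of n] pochhammer_pos[OF r(1), of k]
      by (simp add: field_simps)
    ultimately show ?thesis by simp
  qed
  then have "complex_of_real (pochhammer (r + real n) k / pochhammer r k)
      = of_real (gfact (real k * \<eta> + \<sigma>) (- \<eta>) n / gfact \<sigma> (- \<eta>) n)" by simp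
  ultimately show "poisson_integrand \<alpha> \<beta> \<sigma> ((Re \<alpha> - Re \<beta>) * real n) k =
    (1 - \<beta> / \<alpha>) ^ k * of_real (gfact (real k * eta \<alpha> \<beta> + \<sigma>) (- eta \<alpha> \<beta>) n / gfact \<sigma> (- eta \<alpha> \<beta>) n)"
    unfolding poisson_integrand_pochhammer[OF nz(3,1,2) eta] \<eta>_def[symmetric] r_def[symmetric]
    by (simp add: pochhammer_of_real[symmetric] divide_inverse mult_ac)
qed

text \<open>In polar form cos(pi/2 - Arg \<alpha>) = Im \<alpha> / |\<alpha>| and exp(i(pi/2 - Arg
  \<alpha>)) = i |\<alpha>| / \<alpha>, so twice their product is (\<alpha> - \<beta>) / \<alpha> =
  1 - \<beta> / \<alpha>.\<close>

lemma poisson_integrand_meixner: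
  assumes "meixner_case \<alpha> \<beta>"
  shows "poisson_integrand \<alpha> \<beta> \<sigma> x =
    (\<lambda>\<xi>. of_real (2 * cos (pi / 2 - Arg \<alpha>)) ^ \<xi>
        * inverse (pochhammer (of_real (\<sigma> / eta \<alpha> \<beta>)) \<xi>)
        * exp (\<i> * of_real (pi / 2 - Arg \<alpha>) * of_nat \<xi>)
        * pochhammer (- (\<i> * of_real x) / (2 * of_real (Im \<alpha>))
            - \<i> * of_real \<sigma> * \<alpha> / (2 * of_real (eta \<alpha> \<beta>) * of_real (Im \<alpha>))) \<xi>)"
proof
  fix k
  note case_assm = disjI2[OF disjI2[OF assms]]
  note eta = of_real_eta[OF case_assm]
  have nz: "\<alpha> \<noteq> 0" "\<beta> \<noteq> 0" "\<alpha> \<noteq> \<beta>" and im: "Im \<alpha> > 0" and \<beta>: "\<beta> = cnj \<alpha>"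
    using assms by (auto simp: meixner_case_def complex_eq_iff)
  have diff: "\<alpha> - \<beta> = 2 * \<i> * of_real (Im \<alpha>)" by (simp add: \<beta> complex_eq_iff)
  have "of_real (2 * cos (pi / 2 - Arg \<alpha>)) * exp (\<i> * of_real (pi / 2 - Arg \<alpha>)) = 1 - \<beta> / \<alpha>"
  proof -
    define \<rho> where "\<rho> = cmod \<alpha>"
    have \<rho>: "\<rho> \<noteq> 0" using nz by (simp add: \<rho>_def)
    have polar: "cis (Arg \<alpha>) = \<alpha> / of_real \<rho>"
      unfolding \<rho>_def using nz(1) by (simp add: cis_Arg sgn_eq)
    have "sin (Arg \<alpha>) = Im \<alpha> / \<rho>"
      using arg_cong[OF polar, of Im] by simp
    then have c: "cos (pi / 2 - Arg \<alpha>) = Im \<alpha> / \<rho>" by (simp add: cos_diff)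
    have e: "exp (\<i> * of_real (pi / 2 - Arg \<alpha>)) = \<i> * of_real \<rho> / \<alpha>"
    proof -
      have "exp (\<i> * of_real (pi / 2 - Arg \<alpha>)) = cis (pi / 2) / cis (Arg \<alpha>)"
        by (simp only: cis_divide) (simp only: cis_conv_exp)
      then show ?thesis using \<rho> by (simp add: polar)
    qed
    have "of_real (2 * cos (pi / 2 - Arg \<alpha>)) * exp (\<i> * of_real (pi / 2 - Arg \<alpha>)) = (\<alpha> - \<beta>) / \<alpha>"
      unfolding c e diff using \<rho> by (simp add: field_simps)
    then show ?thesis using nz by (simp add: diff_divide_distrib)
  qed
  then have "(1 - \<beta> / \<alpha>) ^ k = of_real (2 * cos (pi / 2 - Arg \<alpha>)) ^ k * exp (\<i> * of_real (pi / 2 - Arg \<alpha>) * of_nat k)"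
    by (simp only: exp_of_nat2_mult power_mult_distrib[symmetric])
  moreover have "(of_real (x - shift \<alpha> \<beta> \<sigma>) + of_real \<sigma> / \<beta>) / (\<alpha> - \<beta>) = - (\<i> * of_real x) / (2 * of_real (Im \<alpha>))
            - \<i> * of_real \<sigma> * \<alpha> / (2 * of_real (eta \<alpha> \<beta>) * of_real (Im \<alpha>))"
    using im nz assms unfolding diff eta by (simp add: shift_def field_simps)
  ultimately show "poisson_integrand \<alpha> \<beta> \<sigma> x k = of_real (2 * cos (pi / 2 - Arg \<alpha>)) ^ k
        * inverse (pochhammer (of_real (\<sigma> / eta \<alpha> \<beta>)) k)
        * exp (\<i> * of_real (pi / 2 - Arg \<alpha>) * of_nat k)
        * pochhammer (- (\<i> * of_real x) / (2 * of_real (Im \<alpha>))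
            - \<i> * of_real \<sigma> * \<alpha> / (2 * of_real (eta \<alpha> \<beta>) * of_real (Im \<alpha>))) k"
    unfolding poisson_integrand_pochhammer[OF nz(3,1,2) eta] by (simp add: mult_ac)
qed

section \<open>Orthogonal series in L2 and the Fock space\<close>

lemma L2_borel_measurable: "f \<in> L2 M \<Longrightarrow> f \<in> borel_measurable M"
  by (simp add: L2_def)

lemma measurable_cnj [measurable (raw)]:
  "f \<in> borel_measurable M \<Longrightarrow> (\<lambda>x. cnj (f x)) \<in> borel_measurable M"
  by (rule borel_measurable_continuous_on[OF continuous_on_cnj[OF continuous_on_id]])

lemma L2_integrable_mult:
  assumes f: "f \<in> L2 M" and g: "g \<in> L2 M"
  shows "integrable M (\<lambda>x. f x * cnj (g x))"
proof (rule Bochner_Integration.integrable_bound)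
  show "integrable M (\<lambda>x. (cmod (f x))\<^sup>2 + (cmod (g x))\<^sup>2)"
    using f g by (simp add: L2_def)
  show "(\<lambda>x. f x * cnj (g x)) \<in> borel_measurable M"
    using f g by (auto dest!: L2_borel_measurable intro!: borel_measurable_times measurable_cnj)
  have "a * b \<le> a\<^sup>2 + b\<^sup>2" for a b :: real
    using sum_squares_bound[of a b] zero_le_power2[of a] zero_le_power2[of b] by linarith
  then show "AE x in M. cmod (f x * cnj (g x)) \<le> norm ((cmod (f x))\<^sup>2 + (cmod (g x))\<^sup>2)"
    by (simp add: norm_mult)
qed

lemma L2_cmult: "f \<in> L2 M \<Longrightarrow> (\<lambda>x. c * f x) \<in> L2 M"
  by (simp add: L2_def norm_mult power_mult_distrib borel_measurable_times)

lemma L2_add: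
  assumes f: "f \<in> L2 M" and g: "g \<in> L2 M"
  shows "(\<lambda>x. f x + g x) \<in> L2 M"
proof -
  have "integrable M (\<lambda>x. (cmod (f x + g x))\<^sup>2)"
  proof (rule Bochner_Integration.integrable_bound)
    show "integrable M (\<lambda>x. 2 * (cmod (f x))\<^sup>2 + 2 * (cmod (g x))\<^sup>2)"
      using f g by (simp add: L2_def)
    show "(\<lambda>x. (cmod (f x + g x))\<^sup>2) \<in> borel_measurable M"
      using f g by (auto dest!: L2_borel_measurable)
    have "(cmod (a + b))\<^sup>2 \<le> 2 * (cmod a)\<^sup>2 + 2 * (cmod b)\<^sup>2" for a b
    proof -
      have "(cmod (a + b))\<^sup>2 \<le> (cmod a + cmod b)\<^sup>2"
        by (intro power_mono norm_triangle_ineq) simp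
      also have "\<dots> \<le> 2 * (cmod a)\<^sup>2 + 2 * (cmod b)\<^sup>2"
        using sum_squares_bound[of "cmod a" "cmod b"] by (simp add: power2_sum)
      finally show ?thesis .
    qed
    then show "AE x in M. norm ((cmod (f x + g x))\<^sup>2) \<le> norm (2 * (cmod (f x))\<^sup>2 + 2 * (cmod (g x))\<^sup>2)"
      by simp
  qed
  then show ?thesis using f g by (auto simp: L2_def)
qed

lemma L2_sum: "finite I \<Longrightarrow> (\<And>i. i \<in> I \<Longrightarrow> f i \<in> L2 M) \<Longrightarrow> (\<lambda>x. \<Sum>i\<in>I. f i x) \<in> L2 M"
proof (induction I rule: finite_induct)
  case empty
  then show ?case by (simp add: L2_def)
next
  case (insert i I)
  then show ?case by (simp add: L2_add)
qed

text \<open>Young's inequality under the integral. It plays the part of Cauchy-Schwarz: t is fixed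
  small relative to \<open>f\<close>, after which \<open>g\<close> has to be small relative to
  t.\<close>

lemma norm_L2_inner_le:
  assumes f: "f \<in> L2 M" and g: "g \<in> L2 M" and t: "t > 0"
  shows "cmod (L2_inner M f g) \<le> t * (LINT x|M. (cmod (f x))\<^sup>2) + (LINT x|M. (cmod (g x))\<^sup>2) / t"
proof -
  have fg: "integrable M (\<lambda>x. (cmod (f x))\<^sup>2)" "integrable M (\<lambda>x. (cmod (g x))\<^sup>2)"
    using f g by (simp_all add: L2_def)
  have ab: "a * b \<le> t * a\<^sup>2 + b\<^sup>2 / t" if "a \<ge> 0" "b \<ge> 0" for a b :: real
  proof -
    have "t * (a * b) \<le> (t * a)\<^sup>2 + b\<^sup>2"
      using sum_squares_bound[of "t * a" b] zero_le_power2[of "t * a"] zero_le_power2[of b]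
      unfolding mult.assoc by linarith
    then show ?thesis using t by (simp add: field_simps power2_eq_square)
  qed
  have "cmod (L2_inner M f g) \<le> (LINT x|M. t * (cmod (f x))\<^sup>2 + (cmod (g x))\<^sup>2 / t)"
    unfolding L2_inner_def
  proof (rule Bochner_Integration.integral_norm_bound_integral[OF L2_integrable_mult[OF f g]])
    show "integrable M (\<lambda>x. t * (cmod (f x))\<^sup>2 + (cmod (g x))\<^sup>2 / t)" using fg by simp
    show "cmod (f x * cnj (g x)) \<le> t * (cmod (f x))\<^sup>2 + (cmod (g x))\<^sup>2 / t" for x
      using ab[of "cmod (f x)" "cmod (g x)"] by (simp add: norm_mult)
  qed
  also have "\<dots> = t * (LINT x|M. (cmod (f x))\<^sup>2) + (LINT x|M. (cmod (g x))\<^sup>2) / t"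
    using fg by simp
  finally show ?thesis .
qed

lemma L2_inner_sum_right:
  assumes "f \<in> L2 M" "finite I" "\<And>i. i \<in> I \<Longrightarrow> g i \<in> L2 M"
  shows "L2_inner M f (\<lambda>x. \<Sum>i\<in>I. a i * g i x) = (\<Sum>i\<in>I. cnj (a i) * L2_inner M f (g i))"
proof -
  have "L2_inner M f (\<lambda>x. \<Sum>i\<in>I. a i * g i x) = (LINT x|M. (\<Sum>i\<in>I. cnj (a i) * (f x * cnj (g i x))))"
    unfolding L2_inner_def by (intro Bochner_Integration.integral_cong refl) (simp add: sum_distrib_left mult_ac)
  also have "\<dots> = (\<Sum>i\<in>I. LINT x|M. cnj (a i) * (f x * cnj (g i x)))"
    using assms by (intro Bochner_Integration.integral_sum integrable_mult_right L2_integrable_mult) auto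
  finally show ?thesis by (simp add: L2_inner_def)
qed

lemma L2_inner_diff_right:
  assumes "f \<in> L2 M" "g \<in> L2 M" "h \<in> L2 M"
  shows "L2_inner M f (\<lambda>x. g x - h x) = L2_inner M f g - L2_inner M f h"
  using assms by (simp add: L2_inner_def right_diff_distrib L2_integrable_mult)

lemma L2_inner_cnj: "L2_inner M g f = cnj (L2_inner M f g)"
proof -
  have "(\<lambda>x. g x * cnj (f x)) = (\<lambda>x. cnj (f x * cnj (g x)))" by (simp add: mult.commute)
  then show ?thesis by (simp only: L2_inner_def Bochner_Integration.integral_cnj)
qed

lemma L2_inner_self: "L2_inner M f f = of_real (LINT x|M. (cmod (f x))\<^sup>2)"
  unfolding L2_inner_def complex_norm_square[symmetric] by (rule integral_complex_of_real)

text \<open>Fatou's lemma for the squared moduli. It transfers norm bounds on partial sums, and on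
  their differences, to the pointwise limit.\<close>

lemma L2_Fatou:
  fixes F :: "nat \<Rightarrow> real \<Rightarrow> complex"
  assumes F: "\<And>n. F n \<in> L2 M" and lim: "\<And>x. x \<in> space M \<Longrightarrow> (\<lambda>n. F n x) \<longlonglongrightarrow> f x"
    and B: "eventually (\<lambda>n. (LINT x|M. (cmod (F n x))\<^sup>2) \<le> B) sequentially"
  shows "f \<in> L2 M" and "(LINT x|M. (cmod (f x))\<^sup>2) \<le> B"
proof -
  have meas[measurable]: "\<And>n. F n \<in> borel_measurable M" using F by (rule L2_borel_measurable)
  have f[measurable]: "f \<in> borel_measurable M"
    by (rule borel_measurable_LIMSEQ_metric[OF meas lim])
  \<comment> \<open>\<open>ennreal\<close> sends negative reals to 0, so the final bound returns to
    the reals only for nonnegative \<open>B\<close>.\<close>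
  have B0: "B \<ge> 0"
  proof -
    from B obtain n where "(LINT x|M. (cmod (F n x))\<^sup>2) \<le> B" by (auto simp: eventually_sequentially)
    moreover have "0 \<le> (LINT x|M. (cmod (F n x))\<^sup>2)" by simp
    ultimately show ?thesis by linarith
  qed
  have "(\<integral>\<^sup>+ x. ennreal ((cmod (f x))\<^sup>2) \<partial>M)
      = (\<integral>\<^sup>+ x. liminf (\<lambda>n. ennreal ((cmod (F n x))\<^sup>2)) \<partial>M)"
  proof (intro nn_integral_cong)
    fix x assume "x \<in> space M"
    then have "(\<lambda>n. ennreal ((cmod (F n x))\<^sup>2)) \<longlonglongrightarrow> ennreal ((cmod (f x))\<^sup>2)"
      by (intro tendsto_ennrealI tendsto_intros lim)
    then show "ennreal ((cmod (f x))\<^sup>2) = liminf (\<lambda>n. ennreal ((cmod (F n x))\<^sup>2))"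
      by (intro lim_imp_Liminf[symmetric]) auto
  qed
  also have "\<dots> \<le> liminf (\<lambda>n. \<integral>\<^sup>+ x. ennreal ((cmod (F n x))\<^sup>2) \<partial>M)"
    by (intro nn_integral_liminf) measurable
  also have "(\<lambda>n. \<integral>\<^sup>+ x. ennreal ((cmod (F n x))\<^sup>2) \<partial>M) = (\<lambda>n. ennreal (LINT x|M. (cmod (F n x))\<^sup>2))"
    using F by (intro ext nn_integral_eq_integral) (auto simp: L2_def)
  also have "liminf (\<lambda>n. ennreal (LINT x|M. (cmod (F n x))\<^sup>2)) \<le> liminf (\<lambda>n. ennreal B)"
    using B by (intro Liminf_mono) (auto elim!: eventually_mono intro: ennreal_leI)
  also have "\<dots> = ennreal B" by (simp add: Liminf_const)
  finally have le: "(\<integral>\<^sup>+ x. ennreal ((cmod (f x))\<^sup>2) \<partial>M) \<le> ennreal B" .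
  also have "\<dots> < \<infinity>" by simp
  finally have int: "integrable M (\<lambda>x. (cmod (f x))\<^sup>2)"
    by (simp add: integrable_iff_bounded)
  with f show "f \<in> L2 M" by (simp add: L2_def)
  have "ennreal (LINT x|M. (cmod (f x))\<^sup>2) \<le> ennreal B"
    using le nn_integral_eq_integral[OF int] by simp
  then show "(LINT x|M. (cmod (f x))\<^sup>2) \<le> B" using B0 by simp
qed

text \<open>Pythagoras gives the squared norms of finite sums. Fatou turns them into a bound for the
  pointwise limit and for its tails, and small tails let the inner product with \<open>f\<close> be
  taken termwise.\<close>

lemma orthogonal_series:
  fixes s :: "nat \<Rightarrow> real \<Rightarrow> complex" and a :: "nat \<Rightarrow> complex" and c :: "nat \<Rightarrow> real"
  assumes s: "\<And>n. s n \<in> L2 M"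
    and orth: "\<And>m n. L2_inner M (s m) (s n) = (if m = n then of_real (c n) else 0)"
    and a: "summable (\<lambda>n. (cmod (a n))\<^sup>2 * c n)"
    and e: "\<And>x. x \<in> space M \<Longrightarrow> (\<lambda>n. a n * s n x) sums e x"
  shows "e \<in> L2 M"
    and "\<And>f. f \<in> L2 M \<Longrightarrow> (\<lambda>n. cnj (a n) * L2_inner M f (s n)) sums L2_inner M f e"
proof -
  define b where "b n = (cmod (a n))\<^sup>2 * c n" for n
  \<comment> \<open>Nonnegativity is read off from \<open>orth\<close>, which makes
    \<open>c n\<close> a squared norm.\<close>
  have "c n \<ge> 0" for n
  proof -
    have "c n = (LINT x|M. (cmod (s n x))\<^sup>2)"
      using orth[of n n] unfolding L2_inner_self by (simp only: refl if_True of_real_eq_iff)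
    then show ?thesis by simp
  qed
  then have b_nonneg: "b n \<ge> 0" for n by (simp add: b_def)
  have b: "summable b" using a by (simp add: b_def[abs_def])
  \<comment> \<open>Arbitrary finite index sets cover both the partial sums and the blocks between
    two of them.\<close>
  define P where "P I x = (\<Sum>i\<in>I. a i * s i x)" for I x
  have P: "P I \<in> L2 M" if "finite I" for I
    unfolding P_def using that s by (intro L2_sum L2_cmult)
  have inner_P: "L2_inner M f (P I) = (\<Sum>i\<in>I. cnj (a i) * L2_inner M f (s i))"
    if "f \<in> L2 M" "finite I" for f I
    unfolding P_def[abs_def] by (rule L2_inner_sum_right[OF that s])
  have P_norm: "(LINT x|M. (cmod (P I x))\<^sup>2) = sum b I" if "finite I" for I
  proof -
    have "L2_inner M (P I) (P I) = (\<Sum>i\<in>I. cnj (a i) * L2_inner M (P I) (s i))"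
      by (rule inner_P[OF P[OF that] that])
    also have "\<dots> = (\<Sum>i\<in>I. of_real (b i))"
    proof (intro sum.cong refl)
      fix i assume i: "i \<in> I"
      have "L2_inner M (s i) (P I) = (\<Sum>j\<in>I. cnj (a j) * L2_inner M (s i) (s j))"
        by (rule inner_P[OF s that])
      also have "\<dots> = (\<Sum>j\<in>I. if j = i then cnj (a j) * of_real (c j) else 0)"
        by (intro sum.cong refl) (simp add: orth)
      also have "\<dots> = cnj (a i) * of_real (c i)" using that i by simp
      finally show "cnj (a i) * L2_inner M (P I) (s i) = of_real (b i)"
        unfolding L2_inner_cnj[of M "P I"] b_def of_real_mult complex_norm_square by simp
    qed
    finally have "complex_of_real (LINT x|M. (cmod (P I x))\<^sup>2) = of_real (sum b I)"
      by (simp add: L2_inner_self)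
    then show ?thesis by (simp only: of_real_eq_iff)
  qed
  have lim: "(\<lambda>n. P {..<n} x) \<longlonglongrightarrow> e x" if "x \<in> space M" for x
    using e[OF that] by (simp add: sums_def P_def)
  show eL2: "e \<in> L2 M"
  proof (rule L2_Fatou(1))
    show "P {..<n} \<in> L2 M" for n by (rule P) simp
    show "\<forall>\<^sub>F n in sequentially. (LINT x|M. (cmod (P {..<n} x))\<^sup>2) \<le> suminf b"
      using sum_le_suminf[OF b finite_lessThan] b_nonneg by (simp add: P_norm)
  qed (rule lim)
  have diff: "P {..<n} x - P {..<N} x = P {N..<n} x" if "N \<le> n" for N n x
    using sum.atLeastLessThan_concat[of 0 N n "\<lambda>i. a i * s i x"] that
    by (simp add: P_def lessThan_atLeast0 diff_eq_eq add.commute)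
  \<comment> \<open>Fatou again, with N fixed and n tending to infinity: the blocks from N to n have
    squared norm at most the tail of the series of \<open>b\<close>.\<close>
  have tail: "(\<lambda>x. e x - P {..<N} x) \<in> L2 M"
    "(LINT x|M. (cmod (e x - P {..<N} x))\<^sup>2) \<le> suminf b - sum b {..<N}" for N
  proof -
    have "P {..<n} \<in> L2 M" for n by (rule P) simp
    then have 1: "(\<lambda>x. P {..<n} x - P {..<N} x) \<in> L2 M" for n
      using L2_add[OF _ L2_cmult[of _ _ "-1"], of "P {..<n}" M "P {..<N}"] by simp
    have 2: "(\<lambda>n. P {..<n} x - P {..<N} x) \<longlonglongrightarrow> e x - P {..<N} x" if "x \<in> space M" for x
      using lim[OF that] by (intro tendsto_intros)
    have 3: "\<forall>\<^sub>F n in sequentially. (LINT x|M. (cmod (P {..<n} x - P {..<N} x))\<^sup>2) \<le> suminf b - sum b {..<N}"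
      using eventually_ge_at_top[of N]
    proof eventually_elim
      case (elim n)
      have "sum b {..<n} = sum b {..<N} + sum b {N..<n}"
        using sum.atLeastLessThan_concat[of 0 N n b] elim by (simp add: lessThan_atLeast0)
      moreover have "sum b {..<n} \<le> suminf b" using sum_le_suminf[OF b, of "{..<n}"] b_nonneg by simp
      ultimately show ?case using elim by (simp add: diff P_norm)
    qed
    show "(\<lambda>x. e x - P {..<N} x) \<in> L2 M" by (rule L2_Fatou(1)[OF 1 2 3])
    show "(LINT x|M. (cmod (e x - P {..<N} x))\<^sup>2) \<le> suminf b - sum b {..<N}" by (rule L2_Fatou(2)[OF 1 2 3])
  qed
  show "(\<lambda>n. cnj (a n) * L2_inner M f (s n)) sums L2_inner M f e" if f: "f \<in> L2 M" for f
    unfolding sums_def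
  proof (rule metric_LIMSEQ_I)
    fix \<epsilon> :: real assume "\<epsilon> > 0"
    define F where "F = (LINT x|M. (cmod (f x))\<^sup>2)"
    have F0: "F \<ge> 0" by (simp add: F_def)
    \<comment> \<open>This makes t F less than \<epsilon> / 2, and F + 1 keeps t defined when F = 0.
      A tail below t \<epsilon> / 2 supplies the other half.\<close>
    define t where "t = \<epsilon> / (2 * (F + 1))"
    have t: "t > 0" using F0 \<open>\<epsilon> > 0\<close> by (simp add: t_def)
    have tF: "t * F < \<epsilon> / 2" using F0 \<open>\<epsilon> > 0\<close> by (simp add: t_def field_simps)
    have "(\<lambda>N. suminf b - sum b {..<N}) \<longlonglongrightarrow> suminf b - suminf b"
      by (intro tendsto_intros summable_LIMSEQ b)
    then have "\<forall>\<^sub>F N in sequentially. suminf b - sum b {..<N} < t * (\<epsilon> / 2)"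
      using t \<open>\<epsilon> > 0\<close> by (intro order_tendstoD) auto
    then obtain N0 where N0: "\<And>N. N \<ge> N0 \<Longrightarrow> suminf b - sum b {..<N} < t * (\<epsilon> / 2)"
      by (auto simp: eventually_sequentially)
    show "\<exists>N0. \<forall>N\<ge>N0. dist (\<Sum>i<N. cnj (a i) * L2_inner M f (s i)) (L2_inner M f e) < \<epsilon>"
    proof (intro exI allI impI)
      fix N assume N: "N \<ge> N0"
      have PN: "P {..<N} \<in> L2 M" by (rule P) simp
      have "(\<Sum>i<N. cnj (a i) * L2_inner M f (s i)) = L2_inner M f (P {..<N})"
        by (rule inner_P[OF f finite_lessThan, symmetric])
      then have "dist (\<Sum>i<N. cnj (a i) * L2_inner M f (s i)) (L2_inner M f e)
          = cmod (L2_inner M f (\<lambda>x. e x - P {..<N} x))"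
        by (simp add: dist_norm norm_minus_commute L2_inner_diff_right[OF f eL2 PN])
      also have "\<dots> \<le> t * F + (LINT x|M. (cmod (e x - P {..<N} x))\<^sup>2) / t"
        unfolding F_def by (rule norm_L2_inner_le[OF f tail(1) t])
      also have "(LINT x|M. (cmod (e x - P {..<N} x))\<^sup>2) / t < \<epsilon> / 2"
        using order.strict_trans1[OF tail(2) N0[OF N]] t by (simp add: divide_less_eq mult.commute)
      finally show "dist (\<Sum>i<N. cnj (a i) * L2_inner M f (s i)) (L2_inner M f e) < \<epsilon>"
        using tF by simp
    qed
  qed
qed

section \<open>Taylor coefficients and monomials in the Fock space\<close>

lemma taylor_coeff_power: "taylor_coeff (\<lambda>z. z ^ n) k = (if k = n then 1 else 0)"
proof -
  have "(deriv ^^ k) (\<lambda>w. w ^ n) 0 = pochhammer (of_nat (Suc n - k)) k * (0::complex) ^ (n - k)"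
    using higher_deriv_power[of k 0 n 0] by simp
  \<comment> \<open>For k > n truncated subtraction makes the power \<open>0 ^ 0 = 1\<close>; the
    product vanishes because its first factor is \<open>pochhammer 0 k\<close>.\<close>
  moreover have "pochhammer (of_nat (Suc n - k)) k * (0::complex) ^ (n - k) = (if k = n then fact k else 0)"
    by (cases k n rule: linorder_cases) (auto simp: pochhammer_fact pochhammer_0_left)
  ultimately show ?thesis by (simp add: taylor_coeff_def)
qed

lemma Fock_inner_power:
  "Fock_inner \<eta> \<sigma> \<phi> (\<lambda>z. z ^ n) = taylor_coeff \<phi> n * of_real (fact n * gfact \<sigma> (- \<eta>) n)"
proof -
  have "Fock_inner \<eta> \<sigma> \<phi> (\<lambda>z. z ^ n) = (\<Sum>k\<in>{n}. taylor_coeff \<phi> k *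
      cnj (taylor_coeff (\<lambda>z. z ^ n) k) * of_real (fact k * gfact \<sigma> (- \<eta>) k))"
    unfolding Fock_inner_def by (rule suminf_finite) (auto simp: taylor_coeff_power)
  then show ?thesis by (simp add: taylor_coeff_power)
qed

lemma entire_taylor_sums:
  assumes "\<phi> holomorphic_on UNIV"
  shows "(\<lambda>n. taylor_coeff \<phi> n * z ^ n) sums \<phi> z"
  using holomorphic_power_series[of \<phi> 0 "cmod z + 1" z] holomorphic_on_subset[OF assms subset_UNIV]
  by (simp add: taylor_coeff_def)

section \<open>Moments of the measures\<close>

text \<open>The squared modulus of s_n is itself a polynomial, so finite moments suffice. Membership
  has to be proved because unitarity constrains the transform only on \<open>L2\<close>.\<close>

lemma s_fun_in_L2:
  assumes meas: "(\<lambda>x. x) \<in> borel_measurable M"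
    and int: "\<And>n. integrable M (\<lambda>x. x ^ n)"
  shows "s_fun \<alpha> \<beta> \<sigma> n \<in> L2 M"
proof -
  define p where "p = s_poly \<alpha> \<beta> \<sigma> n * s_poly \<alpha> \<beta> \<sigma> n"
  have "(cmod (s_fun \<alpha> \<beta> \<sigma> n x))\<^sup>2 = (\<Sum>i\<le>degree p. coeff p i * x ^ i)" for x
    by (simp add: s_fun_def p_def power2_eq_square flip: poly_altdef)
  moreover have "integrable M (\<lambda>x. \<Sum>i\<le>degree p. coeff p i * x ^ i)"
    by (intro Bochner_Integration.integrable_sum integrable_mult_right int)
  moreover have "continuous_on UNIV (s_fun \<alpha> \<beta> \<sigma> n)"
    unfolding s_fun_def[abs_def] by (intro continuous_intros)
  then have "s_fun \<alpha> \<beta> \<sigma> n \<in> borel_measurable M"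
    using borel_measurable_continuous_on[OF _ meas] by blast
  ultimately show ?thesis by (simp add: L2_def)
qed

text \<open>Up to a constant the n-th moment is Euler's integral with exponent shifted from \<sigma>
  / \<eta> to \<sigma> / \<eta> + n.\<close>

lemma integrable_power_gamma_measure:
  assumes "a > 0" "\<sigma> > 0"
  shows "integrable (gamma_measure a \<sigma>) (\<lambda>x. x ^ n)"
proof -
  define r where "r = \<sigma> / a\<^sup>2"
  have r: "r > 0" using assms by (simp add: r_def)
  define C where "C = 1 / Gamma r * a powr (- r)"
  have C: "C \<ge> 0" using r by (simp add: C_def)
  have dens: "gamma_measure a \<sigma> = density (restrict_space lborel {0<..})
      (\<lambda>x. ennreal (C * x powr (- 1 + r) * exp (- x / a)))"
    by (simp add: gamma_measure_def Let_def r_def C_def)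
  have "set_integrable lebesgue {0<..}
      (\<lambda>t. complex_of_real t powr (of_real (r + n) - 1) / of_real (exp (1 / a * t)))"
    using absolutely_integrable_Gamma_integral[of "of_real (r + n)" "1 / a"] r \<open>a > 0\<close> by simp
  then have "integrable lebesgue (\<lambda>t. norm (indicator {0<..} t *\<^sub>R
      (complex_of_real t powr (of_real (r + n) - 1) / of_real (exp (1 / a * t)))))"
    unfolding set_integrable_def by (rule Bochner_Integration.integrable_norm)
  also have "(\<lambda>t. norm (indicator {0<..} t *\<^sub>R
      (complex_of_real t powr (of_real (r + n) - 1) / of_real (exp (1 / a * t)))))
    = (\<lambda>t. indicator {0<..} t *\<^sub>R (t powr (- 1 + r) * exp (- t / a) * t ^ n))"
  proof
    fix t :: real
    show "norm (indicator {0<..} t *\<^sub>R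
      (complex_of_real t powr (of_real (r + n) - 1) / of_real (exp (1 / a * t))))
      = indicator {0<..} t *\<^sub>R (t powr (- 1 + r) * exp (- t / a) * t ^ n)"
    proof (cases "t > 0")
      case True
      have "t powr (r + n - 1) = t powr (- 1 + r) * t ^ n"
        using True by (simp add: powr_realpow[symmetric] powr_add[symmetric] algebra_simps)
      with True show ?thesis
        by (simp add: norm_divide norm_powr_real_powr exp_minus field_simps)
    qed simp
  qed
  \<comment> \<open>The integrand is Borel, so integrability descends from the completed
    measure.\<close>
  finally have "integrable lborel (\<lambda>t. indicator {0<..} t *\<^sub>R (t powr (- 1 + r) * exp (- t / a) * t ^ n))"
    by (subst (asm) integrable_completion) measurable
  then have "integrable lborel (\<lambda>t. C * (indicator {0<..} t *\<^sub>R (t powr (- 1 + r) * exp (- t / a) * t ^ n)))"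
    by (rule integrable_mult_right)
  then have "integrable (restrict_space lborel {0<..})
      (\<lambda>x. (C * x powr (- 1 + r) * exp (- x / a)) *\<^sub>R x ^ n)"
    by (subst integrable_restrict_space) (auto simp: mult_ac)
  then show ?thesis
    unfolding dens using C
    by (subst integrable_density) (auto intro!: measurable_restrict_space1)
qed

text \<open>Ratio test: consecutive terms of the moment series have quotient tending to q = b / a <
  1, hence eventually below (1 + q) / 2.\<close>

lemma integrable_power_negbin_measure:
  assumes "0 < b" "b < a" "\<sigma> > 0"
  shows "integrable (negbin_measure a b \<sigma>) (\<lambda>x. x ^ m)"
proof -
  define r where "r = \<sigma> / (a * b)"
  define q where "q = b / a"
  define C where "C = (1 - q) powr r"
  have r: "r > 0" and q: "0 < q" "q < 1" and C: "C \<ge> 0"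
    using assms by (auto simp: r_def q_def C_def)
  define w where "w n = C * (q ^ n * (1 / fact n) * pochhammer r n)" for n
  have w: "w n \<ge> 0" for n
    using C q pochhammer_nonneg[OF r] by (simp add: w_def)
  define t where "t n = w n *\<^sub>R ((a - b) * real n) ^ m" for n
  have "(\<lambda>n. (real (Suc n) / real n) ^ m * (q * ((r + real n) / (real n + 1)))) \<longlonglongrightarrow> 1 ^ m * (q * 1)"
  proof (intro tendsto_intros)
    show "(\<lambda>n. real (Suc n) / real n) \<longlonglongrightarrow> 1" by real_asymp
    show "(\<lambda>n. (r + real n) / (real n + 1)) \<longlonglongrightarrow> 1" by real_asymp
  qed
  then have "\<forall>\<^sub>F n in sequentially. (real (Suc n) / real n) ^ m * (q * ((r + real n) / (real n + 1))) < (1 + q) / 2"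
    using q by (intro order_tendstoD) auto
  with eventually_gt_at_top[of 0]
  have "\<forall>\<^sub>F n in sequentially. norm (t (Suc n)) \<le> (1 + q) / 2 * norm (t n)"
  proof eventually_elim
    case (elim n)
    have t0: "t n \<ge> 0" for n using w[of n] assms by (simp add: t_def)
    have "t (Suc n) = (real (Suc n) / real n) ^ m * (q * ((r + real n) / (real n + 1))) * t n"
    proof -
      have "w (Suc n) = q * ((r + real n) / (real n + 1)) * w n"
        by (simp add: w_def pochhammer_Suc field_simps)
      moreover have "((a - b) * real (Suc n)) ^ m = (real (Suc n) / real n) ^ m * ((a - b) * real n) ^ m"
        using elim(1) by (simp add: mult.commute flip: power_mult_distrib)
      ultimately show ?thesis unfolding t_def by simp
    qed
    also have "\<dots> \<le> (1 + q) / 2 * t n"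
      using elim(2) t0[of n] by (intro mult_right_mono) auto
    finally show ?case using t0 by simp
  qed
  then obtain N where "\<And>n. n \<ge> N \<Longrightarrow> norm (t (Suc n)) \<le> (1 + q) / 2 * norm (t n)"
    by (auto simp: eventually_sequentially)
  then have "summable (\<lambda>n. norm (t n))"
    using q by (intro summable_ratio_test[of "(1 + q) / 2" N]) auto
  then have "integrable (density (count_space UNIV) (\<lambda>n. ennreal (w n))) (\<lambda>n. ((a - b) * real n) ^ m)"
    using w by (subst integrable_density) (auto simp: t_def integrable_count_space_nat_iff)
  then show ?thesis
    unfolding negbin_measure_def Let_def r_def[symmetric] q_def[symmetric] C_def[symmetric] w_def[symmetric]
    by (subst integrable_distr_eq) (auto simp: negbin_support_def)
qed

section \<open>Growth of the Gamma function on vertical lines\<close>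

text \<open>In Euler's limit the quotient is a product of factors u / |u + iy| with u = a + k, and
  each of these increases with u. Bounds at integer abscissas thereby pass to real ones.\<close>

lemma norm_Gamma_ratio_mono:
  fixes a b y :: real
  assumes "0 < a" "a \<le> b"
  shows "cmod (Gamma (Complex a y)) / Gamma a \<le> cmod (Gamma (Complex b y)) / Gamma b"
proof (rule LIMSEQ_le)
  define F where "F c n = cmod (Gamma_series (Complex c y) n) / Gamma_series c n" for c n
  have lim: "F c \<longlonglongrightarrow> cmod (Gamma (Complex c y)) / Gamma c" if "c > 0" for c
  proof -
    have "Gamma c \<noteq> 0" using Gamma_real_pos[OF that] by linarith
    then show ?thesis unfolding F_def by (intro tendsto_intros)
  qed
  show "F a \<longlonglongrightarrow> cmod (Gamma (Complex a y)) / Gamma a" "F b \<longlonglongrightarrow> cmod (Gamma (Complex b y)) / Gamma b"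
    using lim assms by auto
  \<comment> \<open>The powers of n cancel because |n^(c + iy)| = n^c.\<close>
  have F: "F c n = (\<Prod>k\<le>n. (c + real k) / cmod (Complex (c + real k) y))" if "c > 0" for c n
  proof -
    have "cmod (exp (Complex c y * of_real (ln (real n)))) = exp (c * ln (real n))" by simp
    moreover have "cmod (pochhammer (Complex c y) (n + 1)) = (\<Prod>k\<le>n. cmod (Complex (c + real k) y))"
      unfolding pochhammer_prod prod_norm[symmetric]
      by (intro prod.cong) (auto simp: complex_eq_iff intro!: arg_cong[where f = cmod])
    moreover have "pochhammer c (n + 1) = (\<Prod>k\<le>n. c + real k)"
      unfolding pochhammer_prod by (intro prod.cong) auto
    ultimately show ?thesis
      unfolding F_def Gamma_series_def by (simp add: norm_mult norm_divide prod_dividef)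
  qed
  have "(\<Prod>k\<le>n. (a + real k) / cmod (Complex (a + real k) y)) \<le> (\<Prod>k\<le>n. (b + real k) / cmod (Complex (b + real k) y))" for n
  proof (intro prod_mono conjI)
    fix k
    define u v where "u = a + real k" and "v = b + real k"
    have uv: "0 < u" "u \<le> v" using assms by (auto simp: u_def v_def)
    \<comment> \<open>After cross-multiplication both numbers have real part uv, so only the
      imaginary parts uy and vy need comparing.\<close>
    have "cmod (Complex (u * v) (u * y)) \<le> cmod (Complex (u * v) (v * y))"
      unfolding cmod_def using uv
      by (auto intro!: real_sqrt_le_mono mult_right_mono power_mono simp: power_mult_distrib)
    moreover have "Complex (u * v) (u * y) = of_real u * Complex v y" "Complex (u * v) (v * y) = of_real v * Complex u y"
      by (auto simp: complex_eq_iff)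
    ultimately have "u * cmod (Complex v y) \<le> v * cmod (Complex u y)"
      using uv by (simp add: norm_mult)
    moreover have "cmod (Complex u y) > 0" "cmod (Complex v y) > 0" using uv by (auto simp: complex_eq_iff)
    ultimately show "u / cmod (Complex u y) \<le> v / cmod (Complex v y)"
      by (simp add: field_simps)
    show "0 \<le> u / cmod (Complex u y)" using uv by simp
  qed
  then show "\<exists>N. \<forall>n\<ge>N. F a n \<le> F b n" using assms by (simp add: F)
qed

text \<open>The reflection formula gives |Gamma(1 + iy)|^2 = u / sinh u with u = pi |y|; the rest is
  an elementary estimate of this quotient.\<close>

lemma norm_Gamma_one_le:
  "(cmod (Gamma (Complex 1 y)))\<^sup>2 \<le> (1 + 2 * pi * \<bar>y\<bar>) * exp (- (pi * \<bar>y\<bar>))"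
\<comment> \<open>At y = 0 the reflection formula degenerates, while the bound is an
  equality.\<close>
proof (cases "y = 0")
  case True
  then show ?thesis by (simp flip: one_complex.code)
next
  case False
  define u where "u = pi * \<bar>y\<bar>"
  have u: "u > 0" using False by (simp add: u_def)
  have cnj: "cnj (Gamma (Complex 1 y)) = Gamma (1 + (- (\<i> * of_real y)))"
    unfolding cnj_Gamma by (rule arg_cong[where f = Gamma]) (simp add: complex_eq_iff)
  have "of_real ((cmod (Gamma (Complex 1 y)))\<^sup>2) = Gamma (Complex 1 y) * Gamma (1 + (- (\<i> * of_real y)))"
    unfolding complex_norm_square cnj ..
  also have "Gamma (1 + (- (\<i> * of_real y))) = - (\<i> * of_real y) * Gamma (- (\<i> * of_real y))"
    using False by (subst add.commute, intro Gamma_plus1) (auto elim!: nonpos_Ints_cases simp: complex_eq_iff)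
  also have "- (\<i> * of_real y) = 1 - Complex 1 y" by (simp add: complex_eq_iff)
  also have "Gamma (Complex 1 y) * ((1 - Complex 1 y) * Gamma (1 - Complex 1 y))
      = (1 - Complex 1 y) * (of_real pi / sin (of_real pi * Complex 1 y))"
    unfolding Gamma_reflection_complex[symmetric] by simp
  finally have "cmod (of_real ((cmod (Gamma (Complex 1 y)))\<^sup>2)) = cmod (1 - Complex 1 y) * pi / cmod (sin (of_real pi * Complex 1 y))"
    by (simp add: norm_mult norm_divide)
  moreover have "cmod (1 - Complex 1 y) = \<bar>y\<bar>" by (simp add: cmod_def)
  moreover have "cmod (sin (of_real pi * Complex 1 y)) = sinh u"
  proof -
    have "of_real pi * Complex 1 y = of_real pi + \<i> * of_real (pi * y)" by (simp add: complex_eq_iff)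
    then have "cmod (sin (of_real pi * Complex 1 y)) = cmod (sin (\<i> * of_real (pi * y)))"
      by (simp add: sin_add flip: sin_of_real cos_of_real)
    also have "\<dots> = cmod (sinh (of_real (pi * y)))"
      by (simp add: sinh_conv_sin norm_mult)
    also have "sinh (complex_of_real (pi * y)) = of_real (sinh (pi * y))"
      by (simp add: sinh_field_def flip: exp_of_real)
    also have "cmod (of_real (sinh (pi * y))) = \<bar>sinh (pi * y)\<bar>" by (rule norm_of_real)
    also have "\<dots> = sinh u"
      by (simp add: u_def abs_if mult_less_0_iff)
    finally show ?thesis .
  qed
  ultimately have eq: "(cmod (Gamma (Complex 1 y)))\<^sup>2 = u / sinh u"
    by (simp add: u_def mult.commute norm_power)
  define e where "e = exp u"
  have e: "e > 0" "exp (- u) = 1 / e" by (simp_all add: e_def exp_minus divide_inverse)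
  have "1 < e" using u by (simp add: e_def)
  then have ee: "1 < e * e" using mult_strict_mono[of 1 e 1 e] by simp
  \<comment> \<open>With e = exp u, the claim reads 2u e^2 / (e^2 - 1) \<le> 1 + 2u, which
    rearranges to this inequality.\<close>
  have "1 + 2 * u \<le> exp (2 * u)" by (rule exp_ge_add_one_self)
  also have "\<dots> = e * e" by (simp add: e_def mult_exp_exp)
  finally have "2 * u * (e * e) \<le> (1 + 2 * u) * (e * e - 1)" by (simp add: algebra_simps)
  then have "2 * u * (e * e) / (e * e - 1) \<le> 1 + 2 * u" using ee by (simp add: pos_divide_le_eq)
  moreover have "u / sinh u = 2 * u * (e * e) / (e * e - 1) * exp (- u)"
    using e ee unfolding sinh_field_def e(2) e_def[symmetric] by (simp add: field_simps)
  ultimately have "u / sinh u \<le> (1 + 2 * u) * exp (- u)"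
    by (simp only: mult_right_mono exp_ge_zero)
  then show ?thesis by (simp add: eq u_def mult.assoc)
qed

text \<open>The functional equation contributes two powers of 1 + |y| per unit step, on top of the
  single one at abscissa 1; the exponential rate is unchanged.\<close>

lemma norm_Gamma_nat_le:
  "\<exists>C>0. \<forall>y. (cmod (Gamma (Complex (real (Suc N)) y)))\<^sup>2 \<le> C * (1 + \<bar>y\<bar>) ^ (2 * N + 1) * exp (- (pi * \<bar>y\<bar>))"
proof (induction N)
  case 0
  have "(cmod (Gamma (Complex 1 y)))\<^sup>2 \<le> (1 + 2 * pi) * (1 + \<bar>y\<bar>) * exp (- (pi * \<bar>y\<bar>))" for y
    by (rule order_trans[OF norm_Gamma_one_le mult_right_mono]) (auto simp: algebra_simps)
  then show ?case by (intro exI[of _ "1 + 2 * pi"]) (auto intro: add_pos_pos)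
next
  case (Suc N)
  then obtain C where C: "C > 0"
    "\<And>y. (cmod (Gamma (Complex (real (Suc N)) y)))\<^sup>2 \<le> C * (1 + \<bar>y\<bar>) ^ (2 * N + 1) * exp (- (pi * \<bar>y\<bar>))"
    by blast
  define k where "k = real (Suc N)"
  have k: "k \<ge> 1" by (simp add: k_def)
  have "(cmod (Gamma (Complex (real (Suc (Suc N))) y)))\<^sup>2
      \<le> (k\<^sup>2 * C) * (1 + \<bar>y\<bar>) ^ (2 * Suc N + 1) * exp (- (pi * \<bar>y\<bar>))" for y
  proof -
    have "Gamma (Complex (real (Suc (Suc N))) y) = Gamma (Complex k y + 1)"
      by (rule arg_cong[where f = Gamma]) (simp add: complex_eq_iff k_def)
    also have "\<dots> = Complex k y * Gamma (Complex k y)"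
      using k by (intro Gamma_plus1) (auto elim!: nonpos_Ints_cases simp: complex_eq_iff)
    finally have "(cmod (Gamma (Complex (real (Suc (Suc N))) y)))\<^sup>2
      = (cmod (Complex k y))\<^sup>2 * (cmod (Gamma (Complex k y)))\<^sup>2"
      by (simp add: norm_mult power_mult_distrib)
    also have "\<dots> \<le> (k\<^sup>2 * (1 + \<bar>y\<bar>)\<^sup>2) * (C * (1 + \<bar>y\<bar>) ^ (2 * N + 1) * exp (- (pi * \<bar>y\<bar>)))"
    proof (intro mult_mono)
      have "cmod (Complex k y) \<le> k + \<bar>y\<bar>" using cmod_le[of "Complex k y"] k by simp
      also have "\<dots> \<le> k * (1 + \<bar>y\<bar>)" using k mult_right_mono[of 1 k "\<bar>y\<bar>"] by (simp add: algebra_simps)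
      finally show "(cmod (Complex k y))\<^sup>2 \<le> k\<^sup>2 * (1 + \<bar>y\<bar>)\<^sup>2"
        by (simp flip: power_mult_distrib add: power_mono)
    qed (use C(2)[of y] in \<open>auto simp: k_def\<close>)
    finally show ?thesis by (simp add: power2_eq_square mult_ac)
  qed
  then show ?case using C(1) k by (intro exI[of _ "k\<^sup>2 * C"]) auto
qed

lemma norm_Gamma_vertical_le:
  assumes "a > 0"
  shows "\<exists>C>0. \<exists>m. \<forall>y. (cmod (Gamma (Complex a y)))\<^sup>2 \<le> C * (1 + \<bar>y\<bar>) ^ m * exp (- (pi * \<bar>y\<bar>))"
proof -
  define N where "N = nat \<lceil>a\<rceil>"
  define b where "b = real (Suc N)"
  have ab: "a \<le> b" unfolding b_def N_def by linarith
  have pos: "Gamma a > 0" "Gamma b > 0" using assms ab by (auto intro: Gamma_real_pos)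
  obtain C where C: "C > 0"
    "\<And>y. (cmod (Gamma (Complex b y)))\<^sup>2 \<le> C * (1 + \<bar>y\<bar>) ^ (2 * N + 1) * exp (- (pi * \<bar>y\<bar>))"
    using norm_Gamma_nat_le[of N] unfolding b_def by blast
  define K where "K = (Gamma a / Gamma b)\<^sup>2"
  have K: "K > 0" using pos by (simp add: K_def)
  have "(cmod (Gamma (Complex a y)))\<^sup>2 \<le> K * C * (1 + \<bar>y\<bar>) ^ (2 * N + 1) * exp (- (pi * \<bar>y\<bar>))" for y
  proof -
    have "cmod (Gamma (Complex a y)) \<le> Gamma a / Gamma b * cmod (Gamma (Complex b y))"
      using norm_Gamma_ratio_mono[OF assms ab, of y] pos by (simp add: field_simps)
    then have "(cmod (Gamma (Complex a y)))\<^sup>2 \<le> K * (cmod (Gamma (Complex b y)))\<^sup>2"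
      unfolding K_def by (simp flip: power_mult_distrib add: power_mono)
    also have "\<dots> \<le> K * (C * (1 + \<bar>y\<bar>) ^ (2 * N + 1) * exp (- (pi * \<bar>y\<bar>)))"
      using K C(2) by (intro mult_left_mono) auto
    finally show ?thesis by (simp add: mult.assoc)
  qed
  then show ?thesis using K C(1) by (intro exI[of _ "K * C"] conjI exI[of _ "2 * N + 1"]) auto
qed

section \<open>Moments in the Meixner case\<close>

lemma power_le_exp:
  fixes c t :: real
  assumes "c > 0" "t \<ge> 0"
  shows "t ^ n \<le> fact n / c ^ n * exp (c * t)"
proof -
  have "(c * t) ^ n /\<^sub>R fact n \<le> exp (c * t)"
    unfolding exp_def using sum_le_suminf[OF summable_exp_generic[of "c * t"], of "{n}"] assms by simp
  then show ?thesis using assms by (simp add: field_simps)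
qed

lemma integrable_inverse_one_plus_square: "integrable lborel (\<lambda>x::real. inverse (1 + x\<^sup>2))"
  using integrable_inverse_1_plus_square by (simp add: set_integrable_def)

text \<open>The Gamma factor decays like exp(-pi |Y x|) up to powers, while the exponential tilt
  grows at most like exp(2 |\<theta>| |Y x|). As 2 |\<theta>| < pi, decay wins, and the integrand is
  dominated by a multiple of 1 / (1 + x^2).\<close>

lemma integrable_power_meixner_measure:
  assumes "Im \<alpha> > 0" "\<sigma> > 0"
  shows "integrable (meixner_measure \<alpha> \<sigma>) (\<lambda>x. x ^ n)"
proof -
  define b \<eta> \<theta> where "b = Im \<alpha>" and "\<eta> = eta \<alpha> (cnj \<alpha>)" and "\<theta> = pi / 2 - Arg \<alpha>"
  \<comment> \<open>Real part and constant imaginary part of the Gamma argument: i \<sigma> (Re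
    \<alpha> - i b) / (2 \<eta> b) = r + i c0.\<close>
  define r c0 where "r = \<sigma> / (2 * \<eta>)" and "c0 = \<sigma> * Re \<alpha> / (2 * \<eta> * b)"
  define Y where "Y x = x / (2 * b) + c0" for x
  have b: "b > 0" using assms by (simp add: b_def)
  have \<eta>: "\<eta> > 0" using b unfolding \<eta>_def eta_def b_def by (auto intro: add_nonneg_pos)
  have r: "r > 0" using \<eta> assms by (simp add: r_def)
  \<comment> \<open>Im \<alpha> > 0 keeps the argument strictly inside (0, pi), which makes the net
    decay rate \<open>c\<close> positive.\<close>
  have "0 < Arg \<alpha>" "Arg \<alpha> < pi" using assms Arg_lt_pi[of \<alpha>] by auto
  then have \<theta>: "2 * \<bar>\<theta>\<bar> < pi" unfolding \<theta>_def by (simp add: abs_if)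
  define c where "c = pi - 2 * \<bar>\<theta>\<bar>"
  have c: "c > 0" using \<theta> by (simp add: c_def)
  define K where "K = meixner_const \<alpha> \<sigma>"
  have K: "K \<ge> 0"
    using b \<eta> assms unfolding K_def meixner_const_def Let_def \<eta>_def[symmetric] b_def[symmetric]
    by (auto intro!: mult_nonneg_nonneg divide_nonneg_nonneg Gamma_real_nonneg)
  define w where "w x = K * exp (\<theta> * x / b) * (cmod (Gamma (Complex r (Y x))))\<^sup>2" for x
  have arg: "\<i> * of_real x / (2 * of_real (Im \<alpha>)) + \<i> * of_real \<sigma> * cnj \<alpha> / (2 * of_real (eta \<alpha> (cnj \<alpha>)) * of_real (Im \<alpha>))
      = Complex r (Y x)" for x
  proof -
    have cnj: "cnj \<alpha> = of_real (Re \<alpha>) - \<i> * of_real b" by (simp add: complex_eq_iff b_def)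
    show ?thesis
      using b \<eta> unfolding b_def[symmetric] \<eta>_def[symmetric] Complex_eq Y_def r_def c0_def unfolding cnj
      by (simp add: field_simps)
  qed
  have dens: "meixner_measure \<alpha> \<sigma> = density lborel (\<lambda>x. ennreal (w x))"
    unfolding meixner_measure_def Let_def arg w_def K_def \<theta>_def b_def ..
  have "continuous_on UNIV (\<lambda>x. Gamma (Complex r (Y x)))"
  proof (rule continuous_on_compose2[OF continuous_on_Gamma[of "{z. Re z > 0}"]])
    show "{z. Re z > 0} \<inter> \<int>\<^sub>\<le>\<^sub>0 = {}" by (auto elim!: nonpos_Ints_cases)
    show "continuous_on UNIV (\<lambda>x. Complex r (Y x))"
      unfolding Complex_eq Y_def using b by (intro continuous_intros) auto
  qed (use r in auto)
  then have [measurable]: "(\<lambda>x. Gamma (Complex r (Y x))) \<in> borel_measurable borel"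
    by (rule borel_measurable_continuous_onI)
  have [measurable]: "w \<in> borel_measurable borel"
    unfolding w_def[abs_def] by measurable
  have w0: "w x \<ge> 0" for x using K by (simp add: w_def)
  obtain C m where C: "C > 0" "\<And>y. (cmod (Gamma (Complex r y)))\<^sup>2 \<le> C * (1 + \<bar>y\<bar>) ^ m * exp (- (pi * \<bar>y\<bar>))"
    using norm_Gamma_vertical_le[OF r] by blast
  define L where "L = 2 * b * (1 + \<bar>c0\<bar>)"
  have L: "L > 0" using b by (simp add: L_def)
  \<comment> \<open>Powers of t = 1 + |Y x| to be absorbed: m from the Gamma bound, n from the
    moment, 2 from the comparison with 1 / (1 + x^2). \<open>D\<close> collects the
    constants.\<close>
  define M where "M = m + n + 2"
  define D where "D = K * exp (2 * \<bar>\<theta>\<bar> * \<bar>c0\<bar>) * C * L ^ n * (1 + L\<^sup>2) * (fact M / c ^ M * exp c)"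
  have bound: "norm (w x *\<^sub>R x ^ n) \<le> norm (D * inverse (1 + x\<^sup>2))" for x
  proof -
    define y where "y = \<bar>Y x\<bar>"
    define t where "t = 1 + y"
    have t: "t \<ge> 1" by (simp add: t_def y_def)
    have xe: "x = 2 * b * (Y x - c0)" using b by (simp add: Y_def)
    have xL: "\<bar>x\<bar> \<le> L * t"
    proof -
      have "\<bar>x\<bar> = 2 * b * \<bar>Y x - c0\<bar>" using b by (subst xe) (simp add: abs_mult)
      also have "\<dots> \<le> 2 * b * (y + \<bar>c0\<bar>)" using b unfolding y_def by (intro mult_left_mono) auto
      also have "\<dots> \<le> 2 * b * ((1 + \<bar>c0\<bar>) * t)"
        using b by (intro mult_left_mono) (auto simp: t_def y_def algebra_simps)
      finally show ?thesis by (simp add: L_def mult.assoc)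
    qed
    have "\<theta> * x / b = 2 * \<theta> * (Y x - c0)" using b by (subst xe) simp
    also have "\<dots> \<le> \<bar>2 * \<theta> * (Y x - c0)\<bar>" by simp
    also have "\<dots> = 2 * \<bar>\<theta>\<bar> * \<bar>Y x - c0\<bar>" by (simp add: abs_mult)
    also have "\<dots> \<le> 2 * \<bar>\<theta>\<bar> * (y + \<bar>c0\<bar>)" unfolding y_def by (intro mult_left_mono) auto
    finally have "exp (\<theta> * x / b) \<le> exp (2 * \<bar>\<theta>\<bar> * \<bar>c0\<bar>) * exp (2 * \<bar>\<theta>\<bar> * y)"
      by (simp add: algebra_simps flip: exp_add)
    then have "w x \<le> K * (exp (2 * \<bar>\<theta>\<bar> * \<bar>c0\<bar>) * exp (2 * \<bar>\<theta>\<bar> * y)) * (C * t ^ m * exp (- (pi * y)))"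
      unfolding w_def t_def y_def using K C(2)[of "Y x"] C(1)
      by (intro mult_mono mult_left_mono mult_nonneg_nonneg) auto
    \<comment> \<open>The exponents combine to -c y, and y = t - 1 accounts for the factor exp
      c.\<close>
    also have "\<dots> = K * exp (2 * \<bar>\<theta>\<bar> * \<bar>c0\<bar>) * C * t ^ m * (exp c * exp (- (c * t)))"
      by (simp add: c_def t_def algebra_simps flip: exp_add)
    finally have w_le: "w x \<le> K * exp (2 * \<bar>\<theta>\<bar> * \<bar>c0\<bar>) * C * t ^ m * (exp c * exp (- (c * t)))" .
    have "\<bar>x\<bar> ^ n \<le> L ^ n * t ^ n" using power_mono[OF xL, of n] by (simp add: power_mult_distrib)
    moreover have "1 + x\<^sup>2 \<le> (1 + L\<^sup>2) * t\<^sup>2"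
    proof -
      have "x\<^sup>2 \<le> L\<^sup>2 * t\<^sup>2" using power_mono[OF xL, of 2] by (simp add: power_mult_distrib)
      moreover have "1 \<le> t\<^sup>2" using t by (simp add: one_le_power)
      ultimately show ?thesis by (simp add: algebra_simps)
    qed
    ultimately have "w x * \<bar>x\<bar> ^ n * (1 + x\<^sup>2) \<le>
        (K * exp (2 * \<bar>\<theta>\<bar> * \<bar>c0\<bar>) * C * t ^ m * (exp c * exp (- (c * t)))) * (L ^ n * t ^ n) * ((1 + L\<^sup>2) * t\<^sup>2)"
      using w_le w0[of x] K C(1) L t by (intro mult_mono) auto
    also have "\<dots> = K * exp (2 * \<bar>\<theta>\<bar> * \<bar>c0\<bar>) * C * L ^ n * (1 + L\<^sup>2) * exp c * (t ^ M * exp (- (c * t)))"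
      by (simp add: M_def power_add power2_eq_square mult_ac)
    also have "\<dots> \<le> K * exp (2 * \<bar>\<theta>\<bar> * \<bar>c0\<bar>) * C * L ^ n * (1 + L\<^sup>2) * exp c * (fact M / c ^ M)"
      using power_le_exp[OF c, of t M] K C(1) L t
      by (intro mult_left_mono) (auto simp: exp_minus field_simps)
    also have "\<dots> = D" by (simp add: D_def mult_ac)
    finally have "w x * \<bar>x\<bar> ^ n \<le> D / (1 + x\<^sup>2)"
      by (subst pos_le_divide_eq) (auto intro: add_pos_nonneg)
    moreover have "norm (w x *\<^sub>R x ^ n) = w x * \<bar>x\<bar> ^ n"
      using w0[of x] by (simp add: abs_mult power_abs)
    ultimately show ?thesis
      unfolding divide_inverse real_norm_def using abs_ge_self order_trans by metis
  qed
  have "integrable lborel (\<lambda>x. w x *\<^sub>R x ^ n)"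
    by (rule Bochner_Integration.integrable_bound[OF integrable_mult_right[OF integrable_inverse_one_plus_square, of D]])
       (use bound in auto)
  then show ?thesis
    unfolding dens using w0 by (subst integrable_density) auto
qed

section \<open>The reproducing kernel\<close>

lemma s_fun_in_L2_mu:
  assumes "0 < \<sigma>" and "gamma_case \<alpha> \<beta> \<or> negbin_case \<alpha> \<beta> \<or> meixner_case \<alpha> \<beta>"
  shows "s_fun \<alpha> \<beta> \<sigma> n \<in> L2 (mu \<alpha> \<beta> \<sigma>)"
proof (rule s_fun_in_L2)
  show "(\<lambda>x. x) \<in> borel_measurable (mu \<alpha> \<beta> \<sigma>)"
    by (auto simp: mu_def gamma_measure_def negbin_measure_def meixner_measure_def Let_def
        intro: measurable_restrict_space1)
  fix m
  show "integrable (mu \<alpha> \<beta> \<sigma>) (\<lambda>x. x ^ m)"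
    using assms unfolding mu_def
    by (auto simp: gamma_case_def negbin_case_def meixner_case_def complex_is_Real_iff
        intro!: integrable_power_gamma_measure integrable_power_negbin_measure
          integrable_power_meixner_measure)
qed

lemma gfact_ge_power:
  assumes "0 < \<sigma>" "0 \<le> \<eta>"
  shows "\<sigma> ^ n \<le> gfact \<sigma> (- \<eta> :: real) n"
proof -
  have "(\<Prod>k<n. \<sigma>) \<le> (\<Prod>k<n. \<sigma> - real k * - \<eta>)"
    using assms by (intro prod_mono) auto
  then show ?thesis by (simp add: gfact_def)
qed

text \<open>Unitarity identifies the inner product of f with s_n as the n-th Taylor coefficient of S
  f times the squared norm of s_n. Expanding the kernel with \<open>orthogonal_series\<close>
  therefore reproduces the Taylor series of S f.\<close>

lemma E_kernel_reproduces:
  assumes \<sigma>: "0 < \<sigma>" and case_assm: "gamma_case \<alpha> \<beta> \<or> negbin_case \<alpha> \<beta> \<or> meixner_case \<alpha> \<beta>"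
    and sb: "segal_bargmann \<alpha> \<beta> \<sigma> S"
  shows "(\<lambda>x. E_kernel \<alpha> \<beta> \<sigma> x z) \<in> L2 (mu \<alpha> \<beta> \<sigma>)"
    and "f \<in> L2 (mu \<alpha> \<beta> \<sigma>) \<Longrightarrow> integrable (mu \<alpha> \<beta> \<sigma>) (\<lambda>x. f x * E_kernel \<alpha> \<beta> \<sigma> x z)"
    and "f \<in> L2 (mu \<alpha> \<beta> \<sigma>) \<Longrightarrow> S f z = (LINT x|mu \<alpha> \<beta> \<sigma>. f x * E_kernel \<alpha> \<beta> \<sigma> x z)"
proof -
  define M s \<eta> where "M = mu \<alpha> \<beta> \<sigma>" and "s = s_fun \<alpha> \<beta> \<sigma>" and "\<eta> = eta \<alpha> \<beta>"
  have \<eta>: "\<eta> > 0" unfolding \<eta>_def by (rule eta_pos) fact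
  define c where "c n = fact n * gfact \<sigma> (- \<eta>) n" for n
  have c: "c n > 0" for n using gfact_pos[OF \<sigma> less_imp_le[OF \<eta>]] by (simp add: c_def)
  have s: "s n \<in> L2 M" for n unfolding s_def M_def by (rule s_fun_in_L2_mu) fact+
  have S_s: "S (s n) = (\<lambda>z. z ^ n)" for n
    using sb by (simp add: segal_bargmann_def s_def)
  have S_Fock: "S f \<in> Fock \<eta> \<sigma>" if "f \<in> L2 M" for f
    using sb that unfolding segal_bargmann_def unitary_L2_Fock_def M_def \<eta>_def by blast
  have inner: "L2_inner M f (s n) = taylor_coeff (S f) n * of_real (c n)" if "f \<in> L2 M" for f n
  proof -
    have "Fock_inner \<eta> \<sigma> (S f) (S (s n)) = L2_inner M f (s n)"
      using sb that s[of n] unfolding segal_bargmann_def unitary_L2_Fock_def M_def \<eta>_def by blast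
    then show ?thesis by (simp add: S_s Fock_inner_power c_def)
  qed
  \<comment> \<open>Orthogonality comes from the transform: \<open>inner\<close> is applied to s_m,
    whose image is a monomial.\<close>
  have orth: "L2_inner M (s m) (s n) = (if m = n then of_real (c n) else 0)" for m n
    by (simp add: inner[OF s] S_s taylor_coeff_power)
  have E_sums: "E_term \<alpha> \<beta> \<sigma> x z sums E_kernel \<alpha> \<beta> \<sigma> x z" for x z
    unfolding E_kernel_def by (intro summable_sums E_term_sums_cpoisson) fact+
  \<comment> \<open>The inner product conjugates its second argument, but the claim has the plain
    kernel. As the s_n are real, pairing with the kernel at \<open>cnj z\<close> repairs
    this.\<close>
  have E_cnj: "cnj (E_kernel \<alpha> \<beta> \<sigma> x (cnj z)) = E_kernel \<alpha> \<beta> \<sigma> x z" for x z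
  proof (rule sums_unique2)
    show "E_term \<alpha> \<beta> \<sigma> x z sums E_kernel \<alpha> \<beta> \<sigma> x z" by (rule E_sums)
    have "(\<lambda>n. cnj (E_term \<alpha> \<beta> \<sigma> x (cnj z) n)) = E_term \<alpha> \<beta> \<sigma> x z"
      by (simp add: E_term_def s_fun_def fun_eq_iff)
    then show "E_term \<alpha> \<beta> \<sigma> x z sums cnj (E_kernel \<alpha> \<beta> \<sigma> x (cnj z))"
      using E_sums[of x "cnj z"] sums_cnj by metis
  qed
  define a where "a z n = z ^ n / of_real (c n)" for z :: complex and n
  \<comment> \<open>Each factor of (\<sigma> | -\<eta>)_n is at least \<sigma>, so the series is
    dominated by that of exp(|z|^2 / \<sigma>).\<close>
  have a_summable: "summable (\<lambda>n. (cmod (a z n))\<^sup>2 * c n)" for z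
  proof (rule summable_comparison_test')
    show "summable (\<lambda>n. inverse (fact n) * ((cmod z)\<^sup>2 / \<sigma>) ^ n)" by (rule summable_exp)
    fix n :: nat
    have "(cmod (a z n))\<^sup>2 * c n = ((cmod z)\<^sup>2) ^ n / c n"
      using c[of n] by (simp add: a_def norm_divide norm_power power_divide power2_eq_square field_simps power_mult_distrib)
    also have "\<dots> \<le> ((cmod z)\<^sup>2) ^ n / (fact n * \<sigma> ^ n)"
      unfolding c_def using gfact_ge_power[OF \<sigma> less_imp_le[OF \<eta>], of n] \<sigma> gfact_pos[OF \<sigma> less_imp_le[OF \<eta>], of n]
      by (intro divide_left_mono mult_left_mono mult_pos_pos) auto
    also have "\<dots> = inverse (fact n) * ((cmod z)\<^sup>2 / \<sigma>) ^ n"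
      by (simp add: power_divide field_simps)
    finally show "norm ((cmod (a z n))\<^sup>2 * c n) \<le> inverse (fact n) * ((cmod z)\<^sup>2 / \<sigma>) ^ n"
      using c[of n] by simp
  qed
  have e: "(\<lambda>n. a z n * s n x) sums E_kernel \<alpha> \<beta> \<sigma> x z" for x z
    using E_sums[of x z] by (simp add: E_term_def[abs_def] a_def c_def s_def \<eta>_def)
  note series = orthogonal_series[OF s orth a_summable e]
  show "(\<lambda>x. E_kernel \<alpha> \<beta> \<sigma> x z) \<in> L2 (mu \<alpha> \<beta> \<sigma>)"
    using series(1) by (simp add: M_def)
  assume "f \<in> L2 (mu \<alpha> \<beta> \<sigma>)"
  then have f: "f \<in> L2 M" by (simp add: M_def)
  show "integrable (mu \<alpha> \<beta> \<sigma>) (\<lambda>x. f x * E_kernel \<alpha> \<beta> \<sigma> x z)"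
    using L2_integrable_mult[OF f series(1)[of "cnj z"]] by (simp only: E_cnj M_def)
  \<comment> \<open>The squared norm in the denominator of \<open>a\<close> cancels the one produced
    by \<open>inner\<close>.\<close>
  have "cnj (a (cnj z) n) * L2_inner M f (s n) = taylor_coeff (S f) n * z ^ n" for n
    using c[of n] by (simp add: inner[OF f] a_def)
  then have "(\<lambda>n. taylor_coeff (S f) n * z ^ n) sums L2_inner M f (\<lambda>x. E_kernel \<alpha> \<beta> \<sigma> x (cnj z))"
    using series(2)[OF f, of "cnj z"] by simp
  moreover have "(\<lambda>n. taylor_coeff (S f) n * z ^ n) sums S f z"
    using S_Fock[OF f] by (intro entire_taylor_sums) (simp add: Fock_def)
  ultimately have "S f z = L2_inner M f (\<lambda>x. E_kernel \<alpha> \<beta> \<sigma> x (cnj z))"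
    by (rule sums_unique2[rotated])
  then show "S f z = (LINT x|mu \<alpha> \<beta> \<sigma>. f x * E_kernel \<alpha> \<beta> \<sigma> x z)"
    by (simp only: L2_inner_def E_cnj M_def)
qed

theorem theorem3p1:
  fixes \<alpha> \<beta> :: complex and \<sigma> :: real
    and S :: "(real \<Rightarrow> complex) \<Rightarrow> complex \<Rightarrow> complex"
  assumes "\<sigma> > 0"
    and "gamma_case \<alpha> \<beta> \<or> negbin_case \<alpha> \<beta> \<or> meixner_case \<alpha> \<beta>"
    and "segal_bargmann \<alpha> \<beta> \<sigma> S"
  shows
    "(\<forall>x\<in>space (mu \<alpha> \<beta> \<sigma>). \<forall>z. summable (E_term \<alpha> \<beta> \<sigma> x z))
     \<and> (\<forall>z. (\<lambda>x. E_kernel \<alpha> \<beta> \<sigma> x z) \<in> L2 (mu \<alpha> \<beta> \<sigma>))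
     \<and> (\<forall>f\<in>L2 (mu \<alpha> \<beta> \<sigma>). \<forall>z.
          integrable (mu \<alpha> \<beta> \<sigma>) (\<lambda>x. f x * E_kernel \<alpha> \<beta> \<sigma> x z)
          \<and> S f z = (LINT x|mu \<alpha> \<beta> \<sigma>. f x * E_kernel \<alpha> \<beta> \<sigma> x z))
     \<and> (gamma_case \<alpha> \<beta> \<longrightarrow>
          (\<forall>x z. x > 0 \<longrightarrow>
             has_cpoisson_integral (z / \<alpha>)
               (\<lambda>\<xi>. inverse (pochhammer (of_real (\<sigma> / eta \<alpha> \<beta>)) \<xi>) * (of_real x / \<alpha>) ^ \<xi>)
               (E_kernel \<alpha> \<beta> \<sigma> x z)))
     \<and> (negbin_case \<alpha> \<beta> \<longrightarrow>
          (\<forall>(n::nat) z.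
             has_cpoisson_integral (z / \<beta>)
               (\<lambda>\<xi>. (1 - \<beta> / \<alpha>) ^ \<xi>
                    * of_real (gfact (real \<xi> * eta \<alpha> \<beta> + \<sigma>) (- eta \<alpha> \<beta>) n
                               / gfact \<sigma> (- eta \<alpha> \<beta>) n))
               (E_kernel \<alpha> \<beta> \<sigma> ((Re \<alpha> - Re \<beta>) * real n) z)))
     \<and> (meixner_case \<alpha> \<beta> \<longrightarrow>
          (\<forall>x z.
             has_cpoisson_integral (z / \<beta>)
               (\<lambda>\<xi>. of_real (2 * cos (pi / 2 - Arg \<alpha>)) ^ \<xi>
                    * inverse (pochhammer (of_real (\<sigma> / eta \<alpha> \<beta>)) \<xi>)
                    * exp (\<i> * of_real (pi / 2 - Arg \<alpha>) * of_nat \<xi>)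
                    * pochhammer (- (\<i> * of_real x) / (2 * of_real (Im \<alpha>))
                        - \<i> * of_real \<sigma> * \<alpha> / (2 * of_real (eta \<alpha> \<beta>) * of_real (Im \<alpha>))) \<xi>)
               (E_kernel \<alpha> \<beta> \<sigma> x z)))"
proof (intro conjI impI ballI allI)
  show "summable (E_term \<alpha> \<beta> \<sigma> x z)" for x z
    by (rule E_term_sums_cpoisson) fact+
  show "(\<lambda>x. E_kernel \<alpha> \<beta> \<sigma> x z) \<in> L2 (mu \<alpha> \<beta> \<sigma>)" for z
    by (rule E_kernel_reproduces) fact+
  show "integrable (mu \<alpha> \<beta> \<sigma>) (\<lambda>x. f x * E_kernel \<alpha> \<beta> \<sigma> x z)"
    and "S f z = (LINT x|mu \<alpha> \<beta> \<sigma>. f x * E_kernel \<alpha> \<beta> \<sigma> x z)" if "f \<in> L2 (mu \<alpha> \<beta> \<sigma>)" for f z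
    using E_kernel_reproduces(2,3)[OF assms that] by auto
  note poisson = E_term_sums_cpoisson(2)[OF assms(1,2)]
  show "has_cpoisson_integral (z / \<alpha>)
      (\<lambda>\<xi>. inverse (pochhammer (of_real (\<sigma> / eta \<alpha> \<beta>)) \<xi>) * (of_real x / \<alpha>) ^ \<xi>)
      (E_kernel \<alpha> \<beta> \<sigma> x z)" if "gamma_case \<alpha> \<beta>" for x z
  proof -
    \<comment> \<open>The general formula has Poisson parameter z / \<beta>; here it has to be read
      as z / \<alpha>.\<close>
    have "\<alpha> = \<beta>" using that by (simp add: gamma_case_def)
    with poisson[of z x] show ?thesis
      unfolding poisson_integrand_gamma[OF that assms(1)] by simp
  qed
  show "has_cpoisson_integral (z / \<beta>)
      (\<lambda>\<xi>. (1 - \<beta> / \<alpha>) ^ \<xi>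
        * of_real (gfact (real \<xi> * eta \<alpha> \<beta> + \<sigma>) (- eta \<alpha> \<beta>) n / gfact \<sigma> (- eta \<alpha> \<beta>) n))
      (E_kernel \<alpha> \<beta> \<sigma> ((Re \<alpha> - Re \<beta>) * real n) z)" if "negbin_case \<alpha> \<beta>" for n z
    using poisson unfolding poisson_integrand_negbin[OF that assms(1), symmetric] .
  show "has_cpoisson_integral (z / \<beta>)
      (\<lambda>\<xi>. of_real (2 * cos (pi / 2 - Arg \<alpha>)) ^ \<xi>
        * inverse (pochhammer (of_real (\<sigma> / eta \<alpha> \<beta>)) \<xi>)
        * exp (\<i> * of_real (pi / 2 - Arg \<alpha>) * of_nat \<xi>)
        * pochhammer (- (\<i> * of_real x) / (2 * of_real (Im \<alpha>))
            - \<i> * of_real \<sigma> * \<alpha> / (2 * of_real (eta \<alpha> \<beta>) * of_real (Im \<alpha>))) \<xi>)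
      (E_kernel \<alpha> \<beta> \<sigma> x z)" if "meixner_case \<alpha> \<beta>" for x z
    using poisson unfolding poisson_integrand_meixner[OF that, symmetric] .
qed

end
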